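(* Let $\mathbb{F}$ be a field and let $\Delta$ be a pure flag simplicial complex. The Gorenstein $\mathbb{F}$-algebra $R_{\Delta}$ has a quadratic Gröbner basis if and only if $\Delta$ is a shellable complex.
   Context: Simplicial complexes. A simplicial complex $\Delta$ on $[n]=\{1,\dots,n\}$ is a nonempty collection of subsets of $[n]$ closed under inclusion. Its elements are called faces, its inclusion-maximal elements facets; $\mathcal{F}(\Delta)$ is the set of facets; $\dim F=|F|-1$, $\dim\Delta$ is the maximal dimension of a face, and $\Delta$ is pure if all facets have the same dimension. The Stanley--Reisner ideal of $\Delta$ is $I_\Delta=(\prod_{i\in F}x_i : F\subseteq [n],\, F\notin\Delta)\subseteq\mathbb{F}[x_1,\dots,x_n]$. $\Delta$ is flag if $I_\Delta$ is generated by monomials of degree $2$ (possibly $I_\Delta=0$). For sets $F_1,\dots,F_r\subseteq[n]$, $\langle F_1,\dots,F_r\rangle$ is the smallest simplicial complex containing them. The algebra $R_\Delta$. Let $\Delta$ be pure of dimension $d-1$, $S=\mathbb{F}[x_1,\dots,x_n,y_1,\dots,y_n]$, $I_\Gamma=I_\Delta S+(x_iy_i: i\in[n])$, $\mathbb{F}[\Gamma]=S/I_\Gamma$ (Cohen--Macaulay of dimension $n$) and $\omega=\mathrm{Ext}^n_S(\mathbb{F}[\Gamma],S(-2n))$ its canonical module. Then $R_\Delta:=\mathbb{F}[\Gamma]\ltimes\omega(n-d-1)$ (Nagata idealization: $A\ltimes M=A\oplus M$ with $(a_1,m_1)(a_2,m_2)=(a_1a_2,a_1m_2+a_2m_1)$,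 graded by $(A\ltimes M)_j=A_j\oplus M_j$; $M(a)_j=M_{a+j}$). It is presented as $R_\Delta=T/J_\Delta$, with $T=S[z_F : F\in\mathcal{F}(\Delta)]$ and $$J_\Delta=I_\Gamma+(x_iz_F : F\in\mathcal{F}(\Delta),\ i\notin F)+(b_{F_1,F_2} : F_1\ne F_2\in\mathcal{F}(\Delta))+(z_F : F\in\mathcal{F}(\Delta))^2,$$ where $b_{F_1,F_2}=\mathbf{y}^{F_1\setminus F_2}z_{F_1}-\mathbf{y}^{F_2\setminus F_1}z_{F_2}$ and $\mathbf{y}^{G}=\prod_{i\in G}y_i$. "$R_\Delta$ has a quadratic Gröbner basis" means: there is a term order on $T$ with respect to which the defining ideal $J_\Delta$ has a Gröbner basis consisting of polynomials of degree $2$. Shellable. A pure $(d-1)$-dimensional complex $\Delta$ is shellable if there is a linear order $F_1,\dots,F_m$ of its facets ($m=|\mathcal{F}(\Delta)|$) such that $\langle F_1,\dots,F_{i-1}\rangle\cap\langle F_i\rangle$ is pure and $(d-2)$-dimensional for every $i=2,\dots,m$. *)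

theory Defs
  imports
    Main
    "HOL-Library.Poly_Mapping"
    "HOL-Algebra.Ring"
    "HOL-Algebra.Ideal"
    "HOL-Algebra.Ideal_Product"
begin

section \<open>Simplicial complexes on $\{1,\dots,n\}$\<close>

definition simplicial_complex :: "nat \<Rightarrow> nat set set \<Rightarrow> bool" where
  "simplicial_complex n \<Delta> \<longleftrightarrow>
     \<Delta> \<noteq> {} \<and> \<Delta> \<subseteq> Pow {1..n} \<and> (\<forall>F\<in>\<Delta>. \<forall>G. G \<subseteq> F \<longrightarrow> G \<in> \<Delta>)"

definition facets :: "nat set set \<Rightarrow> nat set set" where
  "facets \<Delta> = {F\<in>\<Delta>. \<forall>G\<in>\<Delta>. F \<subseteq> G \<longrightarrow> G = F}"

text \<open>Dimensions are integers, since the empty face has dimension $-1$; this value is needed in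
  shellings of 0-dimensional complexes, where the intersections are $\{\emptyset\}$.\<close>

definition face_dim :: "nat set \<Rightarrow> int" where
  "face_dim F = int (card F) - 1"

definition complex_dim :: "nat set set \<Rightarrow> int" where
  "complex_dim \<Delta> = Max (face_dim ` \<Delta>)"

definition pure_complex :: "nat set set \<Rightarrow> bool" where
  "pure_complex \<Delta> \<longleftrightarrow> (\<forall>F\<in>facets \<Delta>. \<forall>G\<in>facets \<Delta>. face_dim F = face_dim G)"

definition generated_complex :: "nat \<Rightarrow> nat set set \<Rightarrow> nat set set" where
  "generated_complex n \<F> = \<Inter> {\<Delta>. simplicial_complex n \<Delta> \<and> \<F> \<subseteq> \<Delta>}"

text \<open>The list \<open>Fs\<close> enumerates the facets from index 0, so the condition on the facets
  $F_2, \dots, F_m$ concerns the indices $1 \le i < m$.\<close>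

definition shellable :: "nat \<Rightarrow> nat set set \<Rightarrow> bool" where
  "shellable n \<Delta> \<longleftrightarrow> pure_complex \<Delta> \<and>
     (\<exists>Fs. distinct Fs \<and> set Fs = facets \<Delta> \<and>
        (\<forall>i. 1 \<le> i \<and> i < length Fs \<longrightarrow>
           (let K = generated_complex n (set (take i Fs)) \<inter> generated_complex n {Fs ! i}
            in pure_complex K \<and> complex_dim K = complex_dim \<Delta> - 1)))"

section \<open>Polynomial rings\<close>

text \<open>A monomial is its exponent function. A polynomial ring on a set \<open>V\<close> of variables consists of
  the polynomials in which only variables from \<open>V\<close> occur; it is a ring record so that ideals are
  ideals of this very ring.\<close>

type_synonym 'v monomial = "'v \<Rightarrow>\<^sub>0 nat"
type_synonym ('v, 'a) mpoly = "'v monomial \<Rightarrow>\<^sub>0 'a"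

definition monomials :: "'v set \<Rightarrow> 'v monomial set" where
  "monomials V = {m. Poly_Mapping.keys m \<subseteq> V}"

definition poly_ring :: "'v set \<Rightarrow> ('v, 'a::comm_ring_1) mpoly ring" where
  "poly_ring V = \<lparr>carrier = {p. Poly_Mapping.keys p \<subseteq> monomials V},
     mult = (*), one = 1, zero = 0, add = (+)\<rparr>"

definition mono_poly :: "'v monomial \<Rightarrow> ('v, 'a::comm_ring_1) mpoly" where
  "mono_poly m = Poly_Mapping.single m 1"

definition indet :: "'v \<Rightarrow> ('v, 'a::comm_ring_1) mpoly" where
  "indet v = mono_poly (Poly_Mapping.single v 1)"

definition mono_degree :: "'v monomial \<Rightarrow> nat" where
  "mono_degree m = (\<Sum>v\<in>Poly_Mapping.keys m. Poly_Mapping.lookup m v)"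

text \<open>Standard grading: every variable (also $z_F$) has degree 1. The zero polynomial gets degree 0, so
  a polynomial of degree 2 is nonzero.\<close>

definition poly_degree :: "('v, 'a::comm_ring_1) mpoly \<Rightarrow> nat" where
  "poly_degree p = Max (insert 0 (mono_degree ` Poly_Mapping.keys p))"

lemma mono_poly_carrier:
  "m \<in> monomials V \<Longrightarrow> mono_poly m \<in> carrier (poly_ring V)"
  by (simp add: mono_poly_def poly_ring_def)

lemma indet_carrier: "v \<in> V \<Longrightarrow> indet v \<in> carrier (poly_ring V)"
  by (simp add: indet_def mono_poly_carrier monomials_def)

lemma cring_poly_ring: "cring (poly_ring V :: ('v, 'a::comm_ring_1) mpoly ring)"
proof (rule cringI)
  have add: "p + q \<in> carrier (poly_ring V)"
    if "p \<in> carrier (poly_ring V)" "q \<in> carrier (poly_ring V)" for p q :: "('v, 'a) mpoly"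
    using that Poly_Mapping.keys_add[of p q] by (auto simp: poly_ring_def)
  have mult: "p * q \<in> carrier (poly_ring V)"
    if "p \<in> carrier (poly_ring V)" "q \<in> carrier (poly_ring V)" for p q :: "('v, 'a) mpoly"
  proof -
    have "m \<in> monomials V" if m: "m \<in> Poly_Mapping.keys (p * q)" for m
    proof -
      obtain a b where ab: "m = a + b" "a \<in> Poly_Mapping.keys p" "b \<in> Poly_Mapping.keys q"
        using m Poly_Mapping.keys_mult[of p q] by auto
      then have "a \<in> monomials V" "b \<in> monomials V"
        using \<open>p \<in> _\<close> \<open>q \<in> _\<close> by (auto simp: poly_ring_def)
      then show ?thesis
        using ab(1) Poly_Mapping.keys_add[of a b] by (auto simp: monomials_def)
    qed
    then show ?thesis by (auto simp: poly_ring_def)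
  qed
  show "abelian_group (poly_ring V :: ('v, 'a) mpoly ring)"
  proof (rule abelian_groupI)
    fix p :: "('v, 'a) mpoly" assume "p \<in> carrier (poly_ring V)"
    then show "\<exists>q\<in>carrier (poly_ring V). q \<oplus>\<^bsub>poly_ring V\<^esub> p = \<zero>\<^bsub>poly_ring V\<^esub>"
      by (intro bexI[of _ "- p"]) (auto simp: poly_ring_def)
  qed (use add in \<open>auto simp: poly_ring_def ac_simps\<close>)
  show "comm_monoid (poly_ring V :: ('v, 'a) mpoly ring)"
    by (rule comm_monoidI)
      (use mult in \<open>auto simp: poly_ring_def monomials_def ac_simps\<close>)
qed (auto simp: poly_ring_def algebra_simps)

section \<open>Term orders and Groebner bases\<close>

definition term_order :: "'v set \<Rightarrow> 'v monomial rel \<Rightarrow> bool" where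
  "term_order V r \<longleftrightarrow> linear_order_on (monomials V) r \<and>
     (\<forall>m\<in>monomials V. (0, m) \<in> r) \<and>
     (\<forall>a b. \<forall>c\<in>monomials V. (a, b) \<in> r \<longrightarrow> (a + c, b + c) \<in> r)"

definition leading_monomial :: "'v monomial rel \<Rightarrow> ('v, 'a::comm_ring_1) mpoly \<Rightarrow> 'v monomial" where
  "leading_monomial r p =
     (THE m. m \<in> Poly_Mapping.keys p \<and> (\<forall>m'\<in>Poly_Mapping.keys p. (m', m) \<in> r))"

definition initial_ideal ::
    "'v set \<Rightarrow> 'v monomial rel \<Rightarrow> ('v, 'a::field) mpoly set \<Rightarrow> ('v, 'a) mpoly set" where
  "initial_ideal V r A = Idl\<^bsub>poly_ring V\<^esub> {mono_poly (leading_monomial r p) |p. p \<in> A \<and> p \<noteq> 0}"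

definition groebner_basis ::
    "'v set \<Rightarrow> 'v monomial rel \<Rightarrow> ('v, 'a::field) mpoly set \<Rightarrow> ('v, 'a) mpoly set \<Rightarrow> bool" where
  "groebner_basis V r I G \<longleftrightarrow>
     finite G \<and> G \<subseteq> I \<and> initial_ideal V r G = initial_ideal V r I"

definition has_quadratic_groebner_basis :: "'v set \<Rightarrow> ('v, 'a::field) mpoly set \<Rightarrow> bool" where
  "has_quadratic_groebner_basis V I \<longleftrightarrow>
     (\<exists>r G. term_order V r \<and> groebner_basis V r I G \<and> (\<forall>g\<in>G. poly_degree g = 2))"

section \<open>Stanley--Reisner ideals and the presentation of $R_\Delta$\<close>

datatype var = X nat | Y nat | Z "nat set"

definition x_vars :: "nat \<Rightarrow> var set" where
  "x_vars n = X ` {1..n}"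

definition S_vars :: "nat \<Rightarrow> var set" where
  "S_vars n = X ` {1..n} \<union> Y ` {1..n}"

definition T_vars :: "nat \<Rightarrow> nat set set \<Rightarrow> var set" where
  "T_vars n \<Delta> = S_vars n \<union> Z ` facets \<Delta>"

definition SR_ideal :: "nat \<Rightarrow> nat set set \<Rightarrow> (var, 'a::field) mpoly set" where
  "SR_ideal n \<Delta> = Idl\<^bsub>poly_ring (x_vars n)\<^esub> {\<Prod>i\<in>F. indet (X i) |F. F \<subseteq> {1..n} \<and> F \<notin> \<Delta>}"

definition flag :: "'a::field itself \<Rightarrow> nat \<Rightarrow> nat set set \<Rightarrow> bool" where
  "flag _ n \<Delta> \<longleftrightarrow>
     (\<exists>M \<subseteq> {m \<in> monomials (x_vars n). mono_degree m = 2}.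
        (SR_ideal n \<Delta> :: (var, 'a) mpoly set) = Idl\<^bsub>poly_ring (x_vars n)\<^esub> (mono_poly ` M))"

definition Gamma_ideal :: "nat \<Rightarrow> nat set set \<Rightarrow> (var, 'a::field) mpoly set" where
  "Gamma_ideal n \<Delta> =
     Idl\<^bsub>poly_ring (S_vars n)\<^esub> (SR_ideal n \<Delta>)
     <+>\<^bsub>poly_ring (S_vars n)\<^esub> Idl\<^bsub>poly_ring (S_vars n)\<^esub> {indet (X i) * indet (Y i) |i. i \<in> {1..n}}"

definition b_poly :: "nat set \<Rightarrow> nat set \<Rightarrow> (var, 'a::field) mpoly" where
  "b_poly F G = (\<Prod>i\<in>F - G. indet (Y i)) * indet (Z F) - (\<Prod>i\<in>G - F. indet (Y i)) * indet (Z G)"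

text \<open>$R_\Delta$ is given by its presentation $T/J_\Delta$, where $T$ is the polynomial ring on
  \<^term>\<open>T_vars n \<Delta>\<close>; the last summand of $J_\Delta$ is the square of the ideal generated by the $z_F$.\<close>

definition J_ideal :: "nat \<Rightarrow> nat set set \<Rightarrow> (var, 'a::field) mpoly set" where
  "J_ideal n \<Delta> =
     (let T = poly_ring (T_vars n \<Delta>);
          Zs = Idl\<^bsub>T\<^esub> {indet (Z F) |F. F \<in> facets \<Delta>}
      in Idl\<^bsub>T\<^esub> (Gamma_ideal n \<Delta>)
         <+>\<^bsub>T\<^esub> Idl\<^bsub>T\<^esub> {indet (X i) * indet (Z F) |i F. F \<in> facets \<Delta> \<and> i \<in> {1..n} - F}
         <+>\<^bsub>T\<^esub> Idl\<^bsub>T\<^esub> {b_poly F G |F G. F \<in> facets \<Delta> \<and> G \<in> facets \<Delta> \<and> F \<noteq> G}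
         <+>\<^bsub>T\<^esub> ideal_prod T Zs Zs)"

end

theory Submission
  imports Defs
begin

text \<open>
  The idea is to send $T$ to the polynomials in \<open>x_i\<close>, \<open>y_i\<close> and one more variable \<open>t\<close> by
  \<open>z_F \<mapsto> y^([n]-F) t\<close>. This maps monomials to monomials. Call a monomial of $T$ vanishing if its image is
  divisible by \<open>t^2\<close>, some \<open>x_i y_i\<close>, or the monomial of a nonface. Each generator of $J_\Delta$ is a
  vanishing monomial or the difference of two monomials with the same image. So $J_\Delta$ lies in the
  kernel of the induced map, and the leading monomial of an element of $J_\Delta$ is vanishing or there is a
  smaller monomial with the same image (\<open>kernel_key\<close>, \<open>J_ideal_props\<close>). Two different
  nonvanishing monomials with the same image contain exactly one \<open>z\<close> each, say \<open>z_F\<close> and \<open>z_E\<close>, with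
  \<open>E \<noteq> F\<close>; the first is then divisible by \<open>y^(F-E) z_F\<close>, a monomial of $b_{F,E}$.

  After multiplication by \<open>y^(F \<inter> E)\<close> the two monomials of $b_{F,E}$ are \<open>y^F z_F\<close> and \<open>y^E z_E\<close>. So a
  term order induces a linear order on the facets, and the leading monomial of $b_{F,E}$ for \<open>E\<close> before
  \<open>F\<close> is \<open>y^(F-E) z_F\<close>. The leading monomials that are quadratic and do not vanish are the \<open>y_v z_F\<close> for
  which there is an earlier facet \<open>H\<close> with \<open>F - H = {v}\<close>. Shellability says that for all \<open>E\<close> before \<open>F\<close> such
  a \<open>v\<close> exists in \<open>F - E\<close> (\<open>shellable_iff\<close>), that is, that some quadratic leading monomial divides
  \<open>y^(F-E) z_F\<close>.

  Hence a quadratic Groebner basis makes the induced order of the facets a shelling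
  (\<open>shellable_if_quadratic\<close>). Conversely, a shelling is the induced order of a lexicographic order, and
  then the quadratic binomials $b_{F,H}$ take care of the nonvanishing leading monomials. The vanishing
  ones have quadratic vanishing divisors because the complex is flag (\<open>quadratic_if_shellable\<close>).
\<close>

abbreviation lookup :: "('a \<Rightarrow>\<^sub>0 'b::zero) \<Rightarrow> 'a \<Rightarrow> 'b" where
  "lookup \<equiv> Poly_Mapping.lookup"

abbreviation keys :: "('a \<Rightarrow>\<^sub>0 'b::zero) \<Rightarrow> 'a set" where
  "keys \<equiv> Poly_Mapping.keys"

section \<open>Ideals of polynomial rings\<close>

lemma carrier_poly_ring: "p \<in> carrier (poly_ring V) \<longleftrightarrow> keys p \<subseteq> monomials V"
  by (simp add: poly_ring_def)

lemma keys_carrier: "p \<in> carrier (poly_ring V) \<Longrightarrow> m \<in> keys p \<Longrightarrow> m \<in> monomials V"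
  by (auto simp: carrier_poly_ring)

lemma poly_ring_ops [simp]:
  "p \<otimes>\<^bsub>poly_ring V\<^esub> q = p * q" "p \<oplus>\<^bsub>poly_ring V\<^esub> q = p + q" "\<zero>\<^bsub>poly_ring V\<^esub> = 0"
  by (simp_all add: poly_ring_def)

lemma ring_poly_ring: "ring (poly_ring V :: ('v, 'a::comm_ring_1) mpoly ring)"
  using cring_poly_ring cring.axioms(1) by blast

lemma monomials_plus: "a \<in> monomials V \<Longrightarrow> b \<in> monomials V \<Longrightarrow> a + b \<in> monomials V"
  using Poly_Mapping.keys_add[of a b] by (auto simp: monomials_def)

lemma ideal_poly_ringI:
  fixes I :: "('v, 'a::comm_ring_1) mpoly set"
  assumes sub: "I \<subseteq> carrier (poly_ring V)" and zero: "0 \<in> I"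
    and add: "\<And>p q. p \<in> I \<Longrightarrow> q \<in> I \<Longrightarrow> p + q \<in> I"
    and mult: "\<And>p q. p \<in> carrier (poly_ring V) \<Longrightarrow> q \<in> I \<Longrightarrow> p * q \<in> I"
  shows "ideal I (poly_ring V)"
proof -
  interpret cring "poly_ring V :: ('v, 'a) mpoly ring" by (rule cring_poly_ring)
  show ?thesis
  proof (rule idealI)
    show "ring (poly_ring V :: ('v, 'a) mpoly ring)" by (rule ring_poly_ring)
    show "subgroup I (add_monoid (poly_ring V))"
    proof (rule group.subgroupI[OF a_group])
      show "I \<subseteq> carrier (add_monoid (poly_ring V))" "I \<noteq> {}"
        using sub zero by auto
    next
      fix p assume p: "p \<in> I"
      have "- 1 \<in> carrier (poly_ring V :: ('v, 'a) mpoly ring)"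
        by (simp add: carrier_poly_ring monomials_def)
      from mult[OF this p] have np: "- p \<in> I" by simp
      then have "\<ominus>\<^bsub>poly_ring V\<^esub> p = - p"
        using p sub by (intro minus_equality) auto
      with np show "inv\<^bsub>add_monoid (poly_ring V)\<^esub> p \<in> I" by (simp add: a_inv_def)
    next
      fix p q :: "('v, 'a) mpoly" assume "p \<in> I" "q \<in> I"
      then show "p \<otimes>\<^bsub>add_monoid (poly_ring V)\<^esub> q \<in> I" using add by simp
    qed
  next
    fix p q :: "('v, 'a) mpoly" assume "p \<in> I" "q \<in> carrier (poly_ring V)"
    then have "q * p \<in> I" using mult by blast
    then show "q \<otimes>\<^bsub>poly_ring V\<^esub> p \<in> I" "p \<otimes>\<^bsub>poly_ring V\<^esub> q \<in> I"
      by (simp_all add: mult.commute)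
  qed
qed

lemma genideal_poly_ring_subset:
  fixes I :: "('v, 'a::comm_ring_1) mpoly set"
  shows "ideal I (poly_ring V) \<Longrightarrow> S \<subseteq> I \<Longrightarrow> Idl\<^bsub>poly_ring V\<^esub> S \<subseteq> I"
  by (rule ring.genideal_minimal[OF ring_poly_ring])

lemma genideal_poly_ring_ideal:
  fixes S :: "('v, 'a::comm_ring_1) mpoly set"
  shows "S \<subseteq> carrier (poly_ring V) \<Longrightarrow> ideal (Idl\<^bsub>poly_ring V\<^esub> S) (poly_ring V)"
  by (rule ring.genideal_ideal[OF ring_poly_ring])

lemma genideal_poly_ring_self:
  fixes S :: "('v, 'a::comm_ring_1) mpoly set"
  shows "S \<subseteq> carrier (poly_ring V) \<Longrightarrow> p \<in> S \<Longrightarrow> p \<in> Idl\<^bsub>poly_ring V\<^esub> S"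
  using ring.genideal_self[OF ring_poly_ring] by blast

lemma ideal_sum_poly_ring:
  fixes A B :: "('v, 'a::comm_ring_1) mpoly set"
  assumes "ideal A (poly_ring V)" "ideal B (poly_ring V)"
  shows "ideal (A <+>\<^bsub>poly_ring V\<^esub> B) (poly_ring V)"
    and "A \<subseteq> A <+>\<^bsub>poly_ring V\<^esub> B" and "B \<subseteq> A <+>\<^bsub>poly_ring V\<^esub> B"
proof -
  show "ideal (A <+>\<^bsub>poly_ring V\<^esub> B) (poly_ring V)"
    by (rule ring.add_ideals[OF ring_poly_ring assms])
  have "0 \<in> A" "0 \<in> B"
    using assms additive_subgroup.zero_closed[OF ideal.axioms(1)] by force+
  then show "A \<subseteq> A <+>\<^bsub>poly_ring V\<^esub> B" "B \<subseteq> A <+>\<^bsub>poly_ring V\<^esub> B"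
    by (force simp: set_add_def')+
qed

lemma ideal_sum_subset:
  fixes I :: "('v, 'a::comm_ring_1) mpoly set"
  assumes "ideal I (poly_ring V)" "A \<subseteq> I" "B \<subseteq> I"
  shows "A <+>\<^bsub>poly_ring V\<^esub> B \<subseteq> I"
  using assms additive_subgroup.a_closed[OF ideal.axioms(1)[OF assms(1)]]
  by (force simp: set_add_def')

section \<open>Monomials and monomial ideals\<close>

lemma mono_poly_mult: "mono_poly a * mono_poly b = mono_poly (a + b)"
  by (simp add: mono_poly_def Poly_Mapping.mult_single)

lemma keys_mono_poly [simp]: "keys (mono_poly m :: ('v, 'a::comm_ring_1) mpoly) = {m}"
  by (simp add: mono_poly_def)

lemma mono_poly_neq_0 [simp]: "(mono_poly m :: ('v, 'a::comm_ring_1) mpoly) \<noteq> 0"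
  using keys_mono_poly[of m] by (metis Poly_Mapping.keys_zero empty_not_insert)

lemma mono_poly_prod: "(\<Prod>i\<in>A. mono_poly (f i)) = mono_poly (\<Sum>i\<in>A. f i)"
  by (induction A rule: infinite_finite_induct)
    (simp_all add: mono_poly_mult, simp_all add: mono_poly_def Poly_Mapping.single_one)

lemma divides_monomial:
  fixes u m :: "'v monomial"
  assumes "\<And>v. lookup u v \<le> lookup m v"
  shows "m = (m - u) + u" and "m \<in> monomials V \<Longrightarrow> m - u \<in> monomials V"
proof -
  show "m = (m - u) + u"
    by (rule poly_mapping_eqI) (use assms in \<open>simp add: Poly_Mapping.lookup_add Poly_Mapping.lookup_minus\<close>)
  show "m - u \<in> monomials V" if "m \<in> monomials V"
    using that by (auto simp: monomials_def in_keys_iff Poly_Mapping.lookup_minus)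
qed

text \<open>The polynomials all of whose monomials are divisible by a member of \<open>U\<close> form an ideal that contains
  the generators.\<close>

lemma mono_poly_in_monomial_ideal:
  fixes U :: "'v monomial set"
  assumes "U \<subseteq> monomials V"
    and "(mono_poly m :: ('v, 'a::comm_ring_1) mpoly) \<in> Idl\<^bsub>poly_ring V\<^esub> (mono_poly ` U)"
  shows "\<exists>u\<in>U. \<forall>v. lookup u v \<le> lookup m v"
proof -
  let ?I = "{p :: ('v, 'a) mpoly. p \<in> carrier (poly_ring V) \<and>
      (\<forall>m\<in>keys p. \<exists>u\<in>U. \<forall>v. lookup u v \<le> lookup m v)}"
  interpret cring "poly_ring V :: ('v, 'a) mpoly ring" by (rule cring_poly_ring)
  have "ideal ?I (poly_ring V)"
  proof (rule ideal_poly_ringI)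
    fix p q assume "p \<in> ?I" "q \<in> ?I"
    then show "p + q \<in> ?I"
      using Poly_Mapping.keys_add[of p q] a_closed[of p q] by (auto simp del: a_closed)
  next
    fix p q :: "('v, 'a) mpoly" assume p: "p \<in> carrier (poly_ring V)" and q: "q \<in> ?I"
    have "\<exists>u\<in>U. \<forall>v. lookup u v \<le> lookup m v" if m: "m \<in> keys (p * q)" for m
    proof -
      obtain a b where ab: "m = a + b" "b \<in> keys q"
        using m Poly_Mapping.keys_mult[of p q] by auto
      then obtain u where "u \<in> U" "\<forall>v. lookup u v \<le> lookup b v" using q by blast
      then show ?thesis using ab(1) by (auto simp: Poly_Mapping.lookup_add intro!: bexI[of _ u] trans_le_add2)
    qed
    then show "p * q \<in> ?I" using p q m_closed[of p q] by auto
  qed (auto simp: carrier_poly_ring)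
  then have "Idl\<^bsub>poly_ring V\<^esub> (mono_poly ` U) \<subseteq> ?I"
    by (rule genideal_poly_ring_subset) (use assms(1) in \<open>auto simp: carrier_poly_ring\<close>)
  with assms(2) have "mono_poly m \<in> ?I" by blast
  then show ?thesis by simp
qed

lemma mono_poly_in_idealI:
  fixes I :: "('v, 'a::comm_ring_1) mpoly set"
  assumes "ideal I (poly_ring V)" "mono_poly u \<in> I" "m \<in> monomials V"
    and "\<And>v. lookup u v \<le> lookup m v"
  shows "mono_poly m \<in> I"
proof -
  have "mono_poly (m - u) \<in> carrier (poly_ring V)"
    using divides_monomial(2)[OF assms(4,3)] by (simp add: carrier_poly_ring)
  then have "mono_poly (m - u) \<otimes>\<^bsub>poly_ring V\<^esub> mono_poly u \<in> I"
    using ideal.I_l_closed[OF assms(1,2)] by blast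
  then show ?thesis
    using divides_monomial(1)[OF assms(4)] by (simp add: mono_poly_mult)
qed

section \<open>Linear functionals on polynomials\<close>

text \<open>Linear functionals serve to show that a polynomial in an ideal cannot consist of too few monomials:
  they vanish on the ideal, and each of them sees only the monomials of nonzero weight.\<close>

definition weigh :: "('v monomial \<Rightarrow> 'a) \<Rightarrow> ('v, 'a::comm_ring_1) mpoly \<Rightarrow> 'a" where
  "weigh f p = (\<Sum>m\<in>keys p. lookup p m * f m)"

lemma weigh_superset:
  "finite A \<Longrightarrow> keys p \<subseteq> A \<Longrightarrow> weigh f p = (\<Sum>m\<in>A. lookup p m * f m)"
  unfolding weigh_def by (rule sum.mono_neutral_left) (auto simp: in_keys_iff)

lemma weigh_add: "weigh f (p + q) = weigh f p + weigh f q"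
proof -
  let ?A = "keys p \<union> keys q"
  show ?thesis
    using Poly_Mapping.keys_add[of p q]
    by (simp add: weigh_superset[of ?A] Poly_Mapping.lookup_add sum.distrib[symmetric] algebra_simps)
qed

lemma weigh_zero [simp]: "weigh f 0 = 0"
  by (simp add: weigh_def)

lemma weigh_single: "weigh f (Poly_Mapping.single m c) = c * f m"
  by (simp add: weigh_superset[of "{m}"])

lemma weigh_mono_poly [simp]: "weigh f (mono_poly m) = f m"
  by (simp add: mono_poly_def weigh_single)

lemma weigh_minus: "weigh f (p - q) = weigh f p - weigh f q"
  using weigh_add[of f "p - q" q] by simp

lemma mpoly_sum_of_terms: "p = (\<Sum>m\<in>keys p. Poly_Mapping.single m (lookup p m))"
  by (rule poly_mapping_eqI) (auto simp: Poly_Mapping.lookup_sum Poly_Mapping.lookup_single when_def in_keys_iff)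

lemma mpoly_induct [case_names zero single add]:
  assumes zero: "P 0" and single: "\<And>m c. P (Poly_Mapping.single m c)"
    and add: "\<And>p q. P p \<Longrightarrow> P q \<Longrightarrow> P (p + q)"
  shows "P (p :: ('v, 'a::comm_ring_1) mpoly)"
proof -
  have "P (\<Sum>m\<in>A. Poly_Mapping.single m (lookup p m))" if "finite A" for A
    using that by (induction A) (auto simp: assms)
  then show ?thesis using mpoly_sum_of_terms[of p] by (metis finite_keys)
qed

lemma weigh_single_mult:
  "weigh f (Poly_Mapping.single t c * p) = c * weigh (\<lambda>m. f (t + m)) p"
  by (induction p rule: mpoly_induct)
    (simp_all add: Poly_Mapping.mult_single weigh_single weigh_add distrib_left algebra_simps)

lemma weigh_mult_eq_0:
  assumes "\<And>t. t \<in> keys p \<Longrightarrow> weigh (\<lambda>m. f (t + m)) q = 0"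
  shows "weigh f (p * q) = 0"
proof -
  have "weigh f ((\<Sum>t\<in>A. Poly_Mapping.single t (lookup p t)) * q) = 0" if "finite A" "A \<subseteq> keys p" for A
    using that by (induction A) (auto simp: distrib_right weigh_add weigh_single_mult assms)
  then show ?thesis using mpoly_sum_of_terms[of p] by (metis finite_keys order_refl)
qed

section \<open>Leading monomials\<close>

lemma linear_order_max:
  assumes "linear_order_on A r" "finite S" "S \<noteq> {}" "S \<subseteq> A"
  shows "\<exists>m\<in>S. \<forall>m'\<in>S. (m', m) \<in> r"
  using assms(2-4)
proof (induction rule: finite_ne_induct)
  case (singleton x)
  then show ?case using assms(1) by (auto simp: order_on_defs refl_on_def)
next
  case (insert x S)
  then obtain m where m: "m \<in> S" "\<forall>m'\<in>S. (m', m) \<in> r" by auto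
  have refl: "(x, x) \<in> r" and "x = m \<or> (x, m) \<in> r \<or> (m, x) \<in> r" and tr: "trans r"
    using insert.prems m(1) assms(1) by (auto simp: order_on_defs refl_on_def total_on_def)
  then show ?case using m tr[THEN transD] by blast
qed

lemma linear_order_antisym: "linear_order_on A r \<Longrightarrow> (a, b) \<in> r \<Longrightarrow> (b, a) \<in> r \<Longrightarrow> a = b"
  by (auto simp: order_on_defs antisym_def)

lemma leading_monomial_eqI:
  assumes "linear_order_on A r" "m \<in> keys p" "\<And>m'. m' \<in> keys p \<Longrightarrow> (m', m) \<in> r"
  shows "leading_monomial r p = m"
  unfolding leading_monomial_def
  using assms by (intro the_equality) (auto intro: linear_order_antisym)

lemma leading_monomial_props:
  fixes p :: "('v, 'a::comm_ring_1) mpoly"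
  assumes r: "linear_order_on (monomials V) r" and p: "p \<in> carrier (poly_ring V)" "p \<noteq> 0"
  shows "leading_monomial r p \<in> keys p"
    and "m' \<in> keys p \<Longrightarrow> (m', leading_monomial r p) \<in> r"
proof -
  obtain m where "m \<in> keys p" "\<forall>m'\<in>keys p. (m', m) \<in> r"
    using linear_order_max[OF r finite_keys] p by (metis carrier_poly_ring keys_eq_empty)
  with leading_monomial_eqI[OF r] have
    "leading_monomial r p \<in> keys p \<and> (\<forall>m'\<in>keys p. (m', leading_monomial r p) \<in> r)" by metis
  then show "leading_monomial r p \<in> keys p"
    and "m' \<in> keys p \<Longrightarrow> (m', leading_monomial r p) \<in> r" by blast+
qed

lemma leading_monomial_mono_poly:
  "linear_order_on (monomials V) r \<Longrightarrow> m \<in> monomials V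
    \<Longrightarrow> leading_monomial r (mono_poly m :: ('v, 'a::comm_ring_1) mpoly) = m"
  by (rule leading_monomial_eqI[of "monomials V"]) (auto simp: order_on_defs refl_on_def)

lemma ex_sorted_list:
  assumes r: "linear_order_on A r" and "finite S" "k ` S \<subseteq> A"
  shows "\<exists>xs. distinct xs \<and> set xs = S \<and> sorted_wrt (\<lambda>a b. (k a, k b) \<in> r) xs"
  using assms(2,3)
proof (induction S rule: finite_psubset_induct)
  case (psubset S)
  show ?case
  proof (cases "S = {}")
    case False
    then obtain x where x: "x \<in> S" "\<forall>y\<in>S. (k y, k x) \<in> r"
      using linear_order_max[OF r, of "k ` S"] psubset.hyps psubset.prems by auto
    obtain xs where "distinct xs" "set xs = S - {x}" "sorted_wrt (\<lambda>a b. (k a, k b) \<in> r) xs"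
      using psubset.IH[of "S - {x}"] x(1) psubset.prems by blast
    with x show ?thesis
      by (intro exI[of _ "xs @ [x]"]) (auto simp: sorted_wrt_append)
  qed auto
qed

text \<open>Membership in an ideal generated by monomials is divisibility by a generator, so the equality of
  initial ideals becomes a divisibility condition on leading monomials. This is the only form in which
  Groebner bases are used below.\<close>

lemma groebner_basis_iff:
  fixes I :: "('v, 'a::field) mpoly set"
  assumes r: "linear_order_on (monomials V) r" and I: "I \<subseteq> carrier (poly_ring V)"
  shows "groebner_basis V r I G \<longleftrightarrow> finite G \<and> G \<subseteq> I \<and>
    (\<forall>p\<in>I. p \<noteq> 0 \<longrightarrow> (\<exists>g\<in>G. g \<noteq> 0 \<and>
       (\<forall>v. lookup (leading_monomial r g) v \<le> lookup (leading_monomial r p) v)))"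
proof -
  define L where "L A = {leading_monomial r p |p :: ('v, 'a) mpoly. p \<in> A \<and> p \<noteq> 0}" for A
  have in_eq: "initial_ideal V r A = Idl\<^bsub>poly_ring V\<^esub> (mono_poly ` L A)" for A :: "('v, 'a) mpoly set"
    unfolding initial_ideal_def L_def by (intro arg_cong[of _ _ "genideal (poly_ring V)"]) blast
  have L_sub: "L A \<subseteq> monomials V" if "A \<subseteq> I" for A
    using leading_monomial_props(1)[OF r] that I unfolding L_def by (blast dest: keys_carrier)
  have carr: "mono_poly ` L A \<subseteq> carrier (poly_ring V :: ('v, 'a) mpoly ring)" if "A \<subseteq> I" for A
    using L_sub[OF that] by (auto simp: carrier_poly_ring)
  have "initial_ideal V r G = initial_ideal V r I \<longleftrightarrow>
      (\<forall>m\<in>L I. \<exists>u\<in>L G. \<forall>v. lookup u v \<le> lookup m v)" (is "?eq \<longleftrightarrow> ?div") if G: "G \<subseteq> I"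
  proof
    assume eq: ?eq
    show ?div
    proof
      fix m assume "m \<in> L I"
      then have "(mono_poly m :: ('v, 'a) mpoly) \<in> initial_ideal V r I"
        unfolding in_eq by (intro genideal_poly_ring_self carr) auto
      then have "(mono_poly m :: ('v, 'a) mpoly) \<in> Idl\<^bsub>poly_ring V\<^esub> (mono_poly ` L G)"
        unfolding eq[symmetric] by (simp add: in_eq)
      then show "\<exists>u\<in>L G. \<forall>v. lookup u v \<le> lookup m v"
        by (rule mono_poly_in_monomial_ideal[OF L_sub[OF G]])
    qed
  next
    assume div: ?div
    have "(mono_poly m :: ('v, 'a) mpoly) \<in> initial_ideal V r G" if m: "m \<in> L I" for m
    proof -
      obtain u where u: "u \<in> L G" "\<And>v. lookup u v \<le> lookup m v" using div m by blast
      have "(mono_poly u :: ('v, 'a) mpoly) \<in> Idl\<^bsub>poly_ring V\<^esub> (mono_poly ` L G)"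
        by (intro genideal_poly_ring_self carr G) (use u(1) in auto)
      moreover have "m \<in> monomials V" using m L_sub[OF order_refl] by blast
      ultimately show ?thesis
        unfolding in_eq
        by (intro mono_poly_in_idealI[OF genideal_poly_ring_ideal[OF carr[OF G]] _ _ u(2)])
    qed
    then have "initial_ideal V r I \<subseteq> initial_ideal V r G"
      unfolding in_eq[of I]
      by (intro genideal_poly_ring_subset)
        (auto simp: in_eq intro!: genideal_poly_ring_ideal[OF carr[OF G]])
    moreover have "L G \<subseteq> L I" using G by (auto simp: L_def)
    then have "initial_ideal V r G \<subseteq> initial_ideal V r I"
      unfolding in_eq
      by (intro genideal_poly_ring_subset genideal_poly_ring_ideal[OF carr])
        (auto intro!: genideal_poly_ring_self carr)
    ultimately show ?eq by blast
  qed
  then show ?thesis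
    unfolding groebner_basis_def by (auto simp: L_def) blast+
qed

section \<open>Lexicographic term orders\<close>

text \<open>The earlier a variable stands in the list, the larger it is. Recursion along the list makes each
  order axiom a one-line induction.\<close>

fun lex_le :: "'v list \<Rightarrow> 'v monomial \<Rightarrow> 'v monomial \<Rightarrow> bool" where
  "lex_le [] m m' \<longleftrightarrow> True"
| "lex_le (v # vs) m m' \<longleftrightarrow>
     lookup m v < lookup m' v \<or> lookup m v = lookup m' v \<and> lex_le vs m m'"

lemma lex_le_refl: "lex_le vs m m"
  by (induction vs) auto

lemma lex_le_trans: "lex_le vs a b \<Longrightarrow> lex_le vs b c \<Longrightarrow> lex_le vs a c"
  by (induction vs) auto

lemma lex_le_total: "lex_le vs a b \<or> lex_le vs b a"
  by (induction vs) auto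

lemma lex_le_antisym: "lex_le vs a b \<Longrightarrow> lex_le vs b a \<Longrightarrow> v \<in> set vs \<Longrightarrow> lookup a v = lookup b v"
  by (induction vs) auto

lemma lex_le_zero: "lex_le vs 0 m"
  by (induction vs) auto

lemma lex_le_add: "lex_le vs a b \<Longrightarrow> lex_le vs (a + c) (b + c)"
  by (induction vs) (auto simp: Poly_Mapping.lookup_add)

lemma lex_le_append:
  "\<forall>v\<in>set us. lookup m v = lookup m' v \<Longrightarrow> lex_le (us @ vs) m m' \<longleftrightarrow> lex_le vs m m'"
  by (induction us) auto

definition lex_order :: "'v list \<Rightarrow> 'v monomial rel" where
  "lex_order vs = {(m, m'). m \<in> monomials (set vs) \<and> m' \<in> monomials (set vs) \<and> lex_le vs m m'}"

lemma term_order_lex_order: "term_order (set vs) (lex_order vs)"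
proof -
  have "a = b" if "(a, b) \<in> lex_order vs" "(b, a) \<in> lex_order vs" for a b
  proof (rule poly_mapping_eqI)
    fix v
    show "lookup a v = lookup b v"
    proof (cases "v \<in> set vs")
      case False
      then have "v \<notin> keys a" "v \<notin> keys b"
        using that by (auto simp: lex_order_def monomials_def)
      then show ?thesis by (simp add: in_keys_iff)
    qed (use that lex_le_antisym[of vs a b v] in \<open>auto simp: lex_order_def\<close>)
  qed
  then have "antisym (lex_order vs)" by (auto simp: antisym_def)
  moreover have "trans (lex_order vs)"
    using lex_le_trans by (auto simp: trans_def lex_order_def)
  ultimately show ?thesis
    using lex_le_total lex_le_refl lex_le_zero lex_le_add
    by (auto simp: term_order_def order_on_defs refl_on_def total_on_def lex_order_def monomials_plus)
       (auto simp: monomials_def)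
qed

section \<open>Shellings\<close>

lemma subset_facet:
  assumes "finite K" "H \<in> K"
  shows "\<exists>P\<in>facets K. H \<subseteq> P"
  using finite_has_maximal2[OF assms] by (auto simp: facets_def)

text \<open>The condition on an intersection in a shelling is a condition on the facets of the intersection
  alone, because every face lies in a facet.\<close>

lemma pure_of_dim_iff:
  assumes "finite K" "K \<noteq> {}" "\<And>H. H \<in> K \<Longrightarrow> finite H"
  shows "pure_complex K \<and> complex_dim K = e \<longleftrightarrow> (\<forall>P\<in>facets K. face_dim P = e)"
proof -
  obtain P where P: "P \<in> facets K" using subset_facet assms(1,2) by blast
  have dim: "complex_dim K = e" if *: "\<forall>P\<in>facets K. face_dim P = e" for e
    unfolding complex_dim_def
  proof (rule Max_eqI)
    show "e \<in> face_dim ` K" using P * by (auto simp: facets_def)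
    fix d assume "d \<in> face_dim ` K"
    then obtain H where H: "H \<in> K" "d = face_dim H" by blast
    with subset_facet[OF assms(1)] obtain Q where "Q \<in> facets K" "H \<subseteq> Q" by blast
    moreover from this have "card H \<le> card Q"
      using assms(3) by (intro card_mono) (auto simp: facets_def)
    ultimately show "d \<le> e" using * H(2) by (auto simp: face_dim_def)
  qed (use assms(1) in simp)
  show ?thesis
  proof
    assume *: "pure_complex K \<and> complex_dim K = e"
    then have eq: "\<forall>Q\<in>facets K. face_dim Q = face_dim P" using P unfolding pure_complex_def by blast
    from dim[OF eq] * have "face_dim P = e" by metis
    with eq show "\<forall>Q\<in>facets K. face_dim Q = e" by metis
  qed (use dim in \<open>auto simp: pure_complex_def\<close>)
qed

lemma generated_complex_eq:
  assumes "S \<noteq> {}" "S \<subseteq> Pow {1..n}"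
  shows "generated_complex n S = {H. \<exists>F\<in>S. H \<subseteq> F}"
proof
  have "simplicial_complex n {H. \<exists>F\<in>S. H \<subseteq> F}"
    unfolding simplicial_complex_def using assms by blast
  then show "generated_complex n S \<subseteq> {H. \<exists>F\<in>S. H \<subseteq> F}"
    unfolding generated_complex_def by (intro Inter_lower) auto
  show "{H. \<exists>F\<in>S. H \<subseteq> F} \<subseteq> generated_complex n S"
    unfolding generated_complex_def simplicial_complex_def by blast
qed

lemma face_subset: "simplicial_complex n \<Delta> \<Longrightarrow> F \<in> \<Delta> \<Longrightarrow> F \<subseteq> {1..n}"
  by (auto simp: simplicial_complex_def)

lemma face_finite: "simplicial_complex n \<Delta> \<Longrightarrow> F \<in> \<Delta> \<Longrightarrow> finite F"
  using finite_subset[OF face_subset] by simp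

lemma complex_finite: "simplicial_complex n \<Delta> \<Longrightarrow> finite \<Delta>"
  by (rule finite_subset[of _ "Pow {1..n}"]) (simp_all add: simplicial_complex_def)

lemma facet_face: "F \<in> facets \<Delta> \<Longrightarrow> F \<in> \<Delta>"
  by (simp add: facets_def)

lemma facet_subset_eq: "F \<in> facets \<Delta> \<Longrightarrow> G \<in> facets \<Delta> \<Longrightarrow> F \<subseteq> G \<Longrightarrow> F = G"
  by (auto simp: facets_def)

lemma facets_card_eq:
  assumes "pure_complex \<Delta>" "F \<in> facets \<Delta>" "G \<in> facets \<Delta>"
  shows "card F = card G"
proof -
  have "face_dim F = face_dim G" using assms unfolding pure_complex_def by blast
  then show ?thesis by (simp add: face_dim_def)
qed

text \<open>If the intersection of the facet \<open>Fs ! j\<close> with the earlier ones is pure of codimension 1 in it, then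
  the face that it shares with an earlier facet \<open>Fs ! i\<close> lies in a facet of this intersection, which has
  the form \<open>Fs ! j - {v}\<close> and is shared with some \<open>Fs ! k\<close>. Conversely, if every shared face lies in such a
  shared \<open>Fs ! j - {v}\<close>, then the maximal shared faces have this form. The vertex \<open>v\<close> becomes the
  variable of the leading monomial \<open>y_v z_F\<close> of a quadratic binomial.\<close>

lemma shellable_iff:
  assumes \<Delta>: "simplicial_complex n \<Delta>" and pure: "pure_complex \<Delta>"
  shows "shellable n \<Delta> \<longleftrightarrow> (\<exists>Fs. distinct Fs \<and> set Fs = facets \<Delta> \<and>
    (\<forall>i j. i < j \<and> j < length Fs \<longrightarrow>
      (\<exists>k<j. \<exists>v\<in>Fs ! j. v \<notin> Fs ! i \<and> Fs ! j - {v} \<subseteq> Fs ! k)))"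
proof -
  have "(let K = generated_complex n (set (take j Fs)) \<inter> generated_complex n {Fs ! j}
            in pure_complex K \<and> complex_dim K = complex_dim \<Delta> - 1) \<longleftrightarrow>
        (\<forall>i<j. \<exists>k<j. \<exists>v\<in>Fs ! j. v \<notin> Fs ! i \<and> Fs ! j - {v} \<subseteq> Fs ! k)"
    (is "?shell \<longleftrightarrow> ?step")
    if dist: "distinct Fs" and set: "set Fs = facets \<Delta>" and j: "1 \<le> j" "j < length Fs" for Fs j
  proof -
    have facet: "Fs ! i \<in> facets \<Delta>" if "i < length Fs" for i
      using nth_mem[OF that] unfolding set .
    have sub: "set Fs \<subseteq> Pow {1..n}"
      using face_subset[OF \<Delta>] unfolding set facets_def by blast
    have take: "set (take j Fs) = {Fs ! i |i. i < j}"
      using nth_image[of j Fs, symmetric] j by auto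
    define K where "K = {H. H \<subseteq> Fs ! j \<and> (\<exists>i<j. H \<subseteq> Fs ! i)}"
    have K: "generated_complex n (set (take j Fs)) \<inter> generated_complex n {Fs ! j} = K"
    proof -
      have "set (take j Fs) \<noteq> {}" "set (take j Fs) \<subseteq> Pow {1..n}"
        using j sub set_take_subset[of j Fs] by auto
      moreover have "{Fs ! j} \<subseteq> Pow {1..n}" using j sub nth_mem by blast
      ultimately show ?thesis
        by (auto simp: generated_complex_eq take K_def)
    qed
    have fin: "finite (Fs ! i)" if "i < length Fs" for i
      by (rule face_finite[OF \<Delta> facet_face[OF facet[OF that]]])
    have finK: "finite K"
      by (rule finite_subset[of _ "Pow (Fs ! j)"]) (use fin j in \<open>auto simp: K_def\<close>)
    have "{} \<in> K" using j by (auto simp: K_def intro!: exI[of _ 0])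
    have dim: "complex_dim \<Delta> = face_dim (Fs ! j)"
    proof -
      have "\<forall>P\<in>facets \<Delta>. face_dim P = face_dim (Fs ! j)"
        using pure facet[OF j(2)] unfolding pure_complex_def by blast
      moreover have "\<Delta> \<noteq> {}" using facet_face[OF facet[OF j(2)]] by auto
      ultimately show ?thesis
        using pure_of_dim_iff[OF complex_finite[OF \<Delta>] _ face_finite[OF \<Delta>],
            of "face_dim (Fs ! j)"] by blast
    qed
    have finH: "finite H" if "H \<in> K" for H
      using that fin[OF j(2)] finite_subset by (auto simp: K_def)
    have "?shell \<longleftrightarrow> (\<forall>P\<in>facets K. face_dim P = face_dim (Fs ! j) - 1)"
      unfolding Let_def K dim
      by (rule pure_of_dim_iff[OF finK _ finH]) (use \<open>{} \<in> K\<close> in auto)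
    also have "\<dots> \<longleftrightarrow> (\<forall>P\<in>facets K. card P + 1 = card (Fs ! j))"
      by (auto simp: face_dim_def)
    also have "\<dots> \<longleftrightarrow> ?step"
    proof
      assume *: "\<forall>P\<in>facets K. card P + 1 = card (Fs ! j)"
      show ?step
      proof (intro allI impI)
        fix i assume i: "i < j"
        then have "Fs ! i \<inter> Fs ! j \<in> K" by (auto simp: K_def)
        then obtain P where P: "P \<in> facets K" "Fs ! i \<inter> Fs ! j \<subseteq> P"
          using subset_facet[OF finK] by blast
        then obtain k where k: "k < j" "P \<subseteq> Fs ! k" "P \<subseteq> Fs ! j"
          by (auto simp: facets_def K_def)
        have "card (Fs ! j - P) = 1"
          using * P(1) k(3) fin[OF j(2)] by (subst card_Diff_subset) (auto dest: finite_subset)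
        then obtain v where v: "Fs ! j - P = {v}" by (meson card_1_singletonE)
        with k P(2) show "\<exists>k<j. \<exists>v\<in>Fs ! j. v \<notin> Fs ! i \<and> Fs ! j - {v} \<subseteq> Fs ! k"
          by (intro exI[of _ k] conjI bexI[of _ v]) auto
      qed
    next
      assume *: ?step
      show "\<forall>P\<in>facets K. card P + 1 = card (Fs ! j)"
      proof
        fix P assume P: "P \<in> facets K"
        then obtain i where i: "i < j" "P \<subseteq> Fs ! i" "P \<subseteq> Fs ! j"
          by (auto simp: facets_def K_def)
        with * obtain k v where kv: "k < j" "v \<in> Fs ! j" "v \<notin> Fs ! i" "Fs ! j - {v} \<subseteq> Fs ! k"
          by blast
        then have "Fs ! j - {v} \<in> K" by (auto simp: K_def)
        moreover have "P \<subseteq> Fs ! j - {v}" using i kv(3) by blast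
        ultimately have "P = Fs ! j - {v}" using P by (auto simp: facets_def)
        then show "card P + 1 = card (Fs ! j)"
          using card_Suc_Diff1[OF fin[OF j(2)] kv(2)] by simp
      qed
    qed
    finally show ?thesis .
  qed
  note step = this
  have "(\<forall>j. 1 \<le> j \<and> j < length Fs \<longrightarrow>
          (let K = generated_complex n (set (take j Fs)) \<inter> generated_complex n {Fs ! j}
            in pure_complex K \<and> complex_dim K = complex_dim \<Delta> - 1)) \<longleftrightarrow>
        (\<forall>i j. i < j \<and> j < length Fs \<longrightarrow>
          (\<exists>k<j. \<exists>v\<in>Fs ! j. v \<notin> Fs ! i \<and> Fs ! j - {v} \<subseteq> Fs ! k))"
    if "distinct Fs" "set Fs = facets \<Delta>" for Fs
  proof -
    have pos: "1 \<le> j" if "i < j" for i j :: nat using that by linarith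
    have "(\<forall>j. 1 \<le> j \<and> j < length Fs \<longrightarrow>
          (let K = generated_complex n (set (take j Fs)) \<inter> generated_complex n {Fs ! j}
            in pure_complex K \<and> complex_dim K = complex_dim \<Delta> - 1)) \<longleftrightarrow>
        (\<forall>j. 1 \<le> j \<and> j < length Fs \<longrightarrow>
          (\<forall>i<j. \<exists>k<j. \<exists>v\<in>Fs ! j. v \<notin> Fs ! i \<and> Fs ! j - {v} \<subseteq> Fs ! k))"
      by (rule all_cong1, rule imp_cong[OF refl], rule step[OF that]) auto
    then show ?thesis by (auto dest: pos)
  qed
  note main = this
  show ?thesis
    unfolding shellable_def
    by (simp only: pure simp_thms, rule ex_cong1, rule conj_cong[OF refl], rule conj_cong[OF refl],
        rule main)
qed

section \<open>Monomials in the variables of $T$\<close>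

text \<open>The squarefree monomial with support \<open>C ` A\<close>, for finite \<open>A\<close> and injective \<open>C\<close>.\<close>

definition sqfree :: "(nat \<Rightarrow> var) \<Rightarrow> nat set \<Rightarrow> var monomial" where
  "sqfree C A = (\<Sum>i\<in>A. Poly_Mapping.single (C i) 1)"

definition yz :: "nat set \<Rightarrow> nat set \<Rightarrow> var monomial" where
  "yz A F = sqfree Y A + Poly_Mapping.single (Z F) 1"

lemma prod_indet: "(\<Prod>i\<in>A. indet (C i)) = mono_poly (sqfree C A)"
  by (simp add: indet_def mono_poly_prod sqfree_def)

lemma b_poly_yz: "b_poly F G = mono_poly (yz (F - G) F) - mono_poly (yz (G - F) G)"
  unfolding b_poly_def prod_indet by (simp add: indet_def mono_poly_mult yz_def)

lemma lookup_sqfree_X: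
  "finite A \<Longrightarrow> lookup (sqfree X A) (X i) = (if i \<in> A then 1 else 0)"
  "lookup (sqfree X A) (Y i) = 0" "lookup (sqfree X A) (Z F) = 0"
  by (simp_all add: sqfree_def Poly_Mapping.lookup_sum Poly_Mapping.lookup_single when_def)

lemma lookup_sqfree_Y:
  "finite A \<Longrightarrow> lookup (sqfree Y A) (Y i) = (if i \<in> A then 1 else 0)"
  "lookup (sqfree Y A) (X i) = 0" "lookup (sqfree Y A) (Z F) = 0"
  by (simp_all add: sqfree_def Poly_Mapping.lookup_sum Poly_Mapping.lookup_single when_def)

lemma lookup_yz:
  "lookup (yz A F) (X i) = 0"
  "finite A \<Longrightarrow> lookup (yz A F) (Y i) = (if i \<in> A then 1 else 0)"
  "lookup (yz A F) (Z G) = (if G = F then 1 else 0)"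
  by (auto simp: yz_def lookup_sqfree_Y Poly_Mapping.lookup_add Poly_Mapping.lookup_single when_def)

lemma lookup_single_var:
  "lookup (Poly_Mapping.single v (1::nat)) w = (if v = w then 1 else 0)"
  by (simp add: Poly_Mapping.lookup_single when_def)

lemma monomials_single: "v \<in> V \<Longrightarrow> Poly_Mapping.single v 1 \<in> monomials V"
  by (simp add: monomials_def)

lemma monomials_sqfree: "C ` A \<subseteq> V \<Longrightarrow> sqfree C A \<in> monomials V"
  unfolding sqfree_def monomials_def
  using Poly_Mapping.keys_sum[of "\<lambda>i. Poly_Mapping.single (C i) (1::nat)" A] by fastforce

lemma monomials_yz: "F \<in> facets \<Delta> \<Longrightarrow> A \<subseteq> {1..n} \<Longrightarrow> yz A F \<in> monomials (T_vars n \<Delta>)"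
  unfolding yz_def by (intro monomials_plus monomials_sqfree monomials_single) (auto simp: T_vars_def S_vars_def)

lemma mono_degree_superset:
  "finite A \<Longrightarrow> keys m \<subseteq> A \<Longrightarrow> mono_degree m = (\<Sum>v\<in>A. lookup m v)"
  unfolding mono_degree_def by (rule sum.mono_neutral_left) (auto simp: in_keys_iff)

lemma mono_degree_plus: "mono_degree (a + b) = mono_degree a + mono_degree b"
  using mono_degree_superset[of "keys a \<union> keys b"] Poly_Mapping.keys_add[of a b]
  by (simp add: Poly_Mapping.lookup_add sum.distrib)

lemma mono_degree_single [simp]: "mono_degree (Poly_Mapping.single v c) = c"
  by (simp add: mono_degree_def)

lemma mono_degree_sqfree: "mono_degree (sqfree C A) = card A"
proof (induction A rule: infinite_finite_induct)
  case (insert x A)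
  then show ?case by (simp add: sqfree_def mono_degree_plus)
qed (simp_all add: sqfree_def mono_degree_def)

lemma mono_degree_yz: "mono_degree (yz A F) = card A + 1"
  by (simp add: yz_def mono_degree_plus mono_degree_sqfree)

lemma mono_degree_mono:
  assumes "\<And>v. lookup u v \<le> lookup m v"
  shows "mono_degree u \<le> mono_degree m"
proof -
  have "keys u \<subseteq> keys m" by (auto simp: in_keys_iff intro: order.strict_trans2[OF _ assms])
  then show ?thesis
    using mono_degree_superset[of "keys m" u] assms by (auto simp: mono_degree_def intro: sum_mono)
qed

lemma poly_degree_mono_poly [simp]:
  "poly_degree (mono_poly m :: ('v, 'a::comm_ring_1) mpoly) = mono_degree m"
  by (simp add: poly_degree_def)

section \<open>Flag complexes\<close>

lemma sqfree_X_le_iff: "finite A \<Longrightarrow> (\<forall>v. lookup (sqfree X A) v \<le> lookup m v) \<longleftrightarrow> (\<forall>i\<in>A. 0 < lookup m (X i))"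
proof
  assume A: "finite A" and *: "\<forall>i\<in>A. 0 < lookup m (X i)"
  have "lookup (sqfree X A) v \<le> lookup m v" for v
    by (cases v) (use A * in \<open>auto simp: lookup_sqfree_X Suc_le_eq\<close>)
  then show "\<forall>v. lookup (sqfree X A) v \<le> lookup m v" by blast
next
  assume A: "finite A" and *: "\<forall>v. lookup (sqfree X A) v \<le> lookup m v"
  show "\<forall>i\<in>A. 0 < lookup m (X i)"
  proof
    fix i assume "i \<in> A"
    then show "0 < lookup m (X i)" using *[rule_format, of "X i"] A by (simp add: lookup_sqfree_X)
  qed
qed

lemma SR_generators:
  "{\<Prod>i\<in>F. indet (X i) |F. F \<subseteq> {1..n} \<and> F \<notin> \<Delta>} = mono_poly ` sqfree X ` {F. F \<subseteq> {1..n} \<and> F \<notin> \<Delta>}"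
  by (auto simp: prod_indet)

text \<open>The squarefree monomial of a nonface \<open>N\<close> is divisible by one of the quadratic generators, which must
  then be \<open>x_i x_j\<close> with distinct \<open>i\<close>, \<open>j\<close> in \<open>N\<close>. This generator lies in the Stanley--Reisner ideal and is
  therefore divisible by the monomial of a nonface, so \<open>{i, j}\<close> contains a nonface.\<close>

lemma flag_nonface_edge:
  assumes \<Delta>: "simplicial_complex n \<Delta>" and flag: "flag TYPE('a::field) n \<Delta>"
    and N: "N \<subseteq> {1..n}" "N \<notin> \<Delta>"
  shows "\<exists>i\<in>N. \<exists>j\<in>N. i \<noteq> j \<and> {i, j} \<notin> \<Delta>"
proof -
  let ?R = "poly_ring (x_vars n) :: (var, 'a) mpoly ring"
  let ?N = "{F. F \<subseteq> {1..n} \<and> F \<notin> \<Delta>}"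
  have fin: "finite A" if "A \<subseteq> {1..n}" for A :: "nat set" using that finite_subset by blast
  have N_mon: "sqfree X ` ?N \<subseteq> monomials (x_vars n)"
    by (auto intro!: monomials_sqfree simp: x_vars_def)
  have SR: "SR_ideal n \<Delta> = Idl\<^bsub>?R\<^esub> (mono_poly ` sqfree X ` ?N)"
    unfolding SR_ideal_def SR_generators ..
  obtain M where M: "M \<subseteq> {m \<in> monomials (x_vars n). mono_degree m = 2}"
    and SR_M: "SR_ideal n \<Delta> = Idl\<^bsub>?R\<^esub> (mono_poly ` M)"
    using flag unfolding flag_def by blast
  have "(mono_poly (sqfree X N) :: (var, 'a) mpoly) \<in> SR_ideal n \<Delta>"
    unfolding SR
    by (rule genideal_poly_ring_self)
      (use N N_mon in \<open>auto simp: carrier_poly_ring image_subset_iff\<close>)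
  then obtain q where q: "q \<in> M" "\<forall>v. lookup q v \<le> lookup (sqfree X N) v"
    using mono_poly_in_monomial_ideal[of M "x_vars n"] M unfolding SR_M by blast
  define P where "P = {i. 0 < lookup q (X i)}"
  have q_le: "lookup q (X i) \<le> (if i \<in> N then 1 else 0)" for i
    using q(2)[rule_format, of "X i"] fin[OF N(1)] by (simp add: lookup_sqfree_X)
  then have P: "P \<subseteq> N" unfolding P_def by (smt (verit) le_zero_eq mem_Collect_eq not_gr_zero subsetI)
  have "q = sqfree X P"
  proof (rule poly_mapping_eqI)
    fix v
    have "keys q \<subseteq> X ` {1..n}" using q(1) M by (auto simp: monomials_def x_vars_def)
    then have "v \<notin> range X \<Longrightarrow> lookup q v = 0" by (auto simp: in_keys_iff)
    moreover have "finite P" using P fin N(1) by (meson finite_subset)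
    moreover have "lookup q (X i) = (if i \<in> P then 1 else 0)" for i
      using q_le[of i] by (auto simp: P_def split: if_splits)
    ultimately show "lookup q v = lookup (sqfree X P) v"
      by (cases v) (auto simp: lookup_sqfree_X)
  qed
  then have card: "card P = 2" using q(1) M mono_degree_sqfree[of X P] by auto
  then obtain i j where ij: "P = {i, j}" "i \<noteq> j" by (auto simp: card_2_iff)
  have "(mono_poly q :: (var, 'a) mpoly) \<in> SR_ideal n \<Delta>"
    unfolding SR_M
    by (rule genideal_poly_ring_self) (use M q(1) in \<open>auto simp: carrier_poly_ring\<close>)
  then obtain N' where N': "N' \<subseteq> {1..n}" "N' \<notin> \<Delta>" "\<forall>v. lookup (sqfree X N') v \<le> lookup q v"
    using mono_poly_in_monomial_ideal[OF N_mon] unfolding SR by blast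
  then have "N' \<subseteq> P" unfolding sqfree_X_le_iff[OF fin[OF N'(1)]] P_def by blast
  then have "P \<notin> \<Delta>" using N'(2) \<Delta> unfolding simplicial_complex_def by blast
  then show ?thesis using ij P by blast
qed

section \<open>Images of monomials under $z_F \mapsto y^{[n]-F}t$\<close>

text \<open>The exponents of \<open>y_i\<close> and \<open>t\<close> in the image of \<open>m\<close> under \<open>x_i \<mapsto> x_i\<close>, \<open>y_i \<mapsto> y_i\<close>,
  \<open>z_F \<mapsto> y^([n]-F) t\<close>; the exponent of \<open>x_i\<close> is that in \<open>m\<close>. Indices \<open>i\<close> outside \<open>{1..n}\<close> count as lying
  outside every facet. For a monomial in the variables of $T$ the value of \<open>y_exp\<close> at such an index is
  \<open>t_exp\<close>, so that this does not change which monomials have the same image.\<close>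

definition y_exp :: "nat set set \<Rightarrow> var monomial \<Rightarrow> nat \<Rightarrow> nat" where
  "y_exp \<Delta> m i = lookup m (Y i) + (\<Sum>F\<in>facets \<Delta>. if i \<in> F then 0 else lookup m (Z F))"

definition t_exp :: "nat set set \<Rightarrow> var monomial \<Rightarrow> nat" where
  "t_exp \<Delta> m = (\<Sum>F\<in>facets \<Delta>. lookup m (Z F))"

definition same_image :: "nat set set \<Rightarrow> var monomial \<Rightarrow> var monomial \<Rightarrow> bool" where
  "same_image \<Delta> m m' \<longleftrightarrow> (\<forall>i. lookup m (X i) = lookup m' (X i)) \<and>
     (\<forall>i. y_exp \<Delta> m i = y_exp \<Delta> m' i) \<and> t_exp \<Delta> m = t_exp \<Delta> m'"

text \<open>The image of \<open>m\<close> lies in the monomial ideal generated by \<open>t^2\<close>, the products \<open>x_i y_i\<close> and the nonface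
  monomials.\<close>

definition vanishing :: "nat set set \<Rightarrow> var monomial \<Rightarrow> bool" where
  "vanishing \<Delta> m \<longleftrightarrow> 2 \<le> t_exp \<Delta> m \<or> (\<exists>i. 0 < lookup m (X i) \<and> 0 < y_exp \<Delta> m i) \<or>
     {i. 0 < lookup m (X i)} \<notin> \<Delta>"

lemma y_exp_plus: "y_exp \<Delta> (a + b) i = y_exp \<Delta> a i + y_exp \<Delta> b i"
proof -
  have "(\<Sum>F\<in>facets \<Delta>. if i \<in> F then 0 else lookup (a + b) (Z F))
      = (\<Sum>F\<in>facets \<Delta>. (if i \<in> F then 0 else lookup a (Z F)) + (if i \<in> F then 0 else lookup b (Z F)))"
    by (rule sum.cong) (auto simp: Poly_Mapping.lookup_add)
  then show ?thesis by (simp add: y_exp_def Poly_Mapping.lookup_add sum.distrib)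
qed

lemma t_exp_plus: "t_exp \<Delta> (a + b) = t_exp \<Delta> a + t_exp \<Delta> b"
  by (simp add: t_exp_def Poly_Mapping.lookup_add sum.distrib)

lemma same_image_plus: "same_image \<Delta> m m' \<Longrightarrow> same_image \<Delta> (t + m) (t + m')"
  by (simp add: same_image_def y_exp_plus t_exp_plus Poly_Mapping.lookup_add)

lemma same_image_sym: "same_image \<Delta> m m' \<Longrightarrow> same_image \<Delta> m' m"
  by (simp add: same_image_def)

lemma same_image_trans: "same_image \<Delta> a b \<Longrightarrow> same_image \<Delta> b c \<Longrightarrow> same_image \<Delta> a c"
  by (simp add: same_image_def)

lemma same_image_vanishing: "same_image \<Delta> m m' \<Longrightarrow> vanishing \<Delta> m \<longleftrightarrow> vanishing \<Delta> m'"
  by (simp add: same_image_def vanishing_def)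

lemma vanishing_plus:
  assumes \<Delta>: "simplicial_complex n \<Delta>" and m: "vanishing \<Delta> m"
  shows "vanishing \<Delta> (t + m)"
proof -
  have "{i. 0 < lookup m (X i)} \<subseteq> {i. 0 < lookup (t + m) (X i)}"
    by (auto simp: Poly_Mapping.lookup_add)
  then have "{i. 0 < lookup m (X i)} \<notin> \<Delta> \<Longrightarrow> {i. 0 < lookup (t + m) (X i)} \<notin> \<Delta>"
    using \<Delta> unfolding simplicial_complex_def by blast
  then show ?thesis
    using m by (auto simp: vanishing_def t_exp_plus y_exp_plus Poly_Mapping.lookup_add)
qed

lemma facets_finite: "simplicial_complex n \<Delta> \<Longrightarrow> finite (facets \<Delta>)"
  using complex_finite by (simp add: facets_def)

lemma t_exp_1:
  assumes \<Delta>: "simplicial_complex n \<Delta>" and m: "t_exp \<Delta> m = 1"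
  obtains F where "F \<in> facets \<Delta>" "\<And>G. G \<in> facets \<Delta> \<Longrightarrow> lookup m (Z G) = (if G = F then 1 else 0)"
    "\<And>i. y_exp \<Delta> m i = lookup m (Y i) + (if i \<in> F then 0 else 1)"
proof -
  obtain F where F: "F \<in> facets \<Delta>" "lookup m (Z F) = 1"
      "\<And>G. G \<in> facets \<Delta> \<Longrightarrow> F \<noteq> G \<Longrightarrow> lookup m (Z G) = 0"
    using m sum_eq_1_iff[OF facets_finite[OF \<Delta>], of "\<lambda>F. lookup m (Z F)"] by (auto simp: t_exp_def)
  have "(\<Sum>G\<in>facets \<Delta>. if i \<in> G then 0 else lookup m (Z G)) = (\<Sum>G\<in>{F}. if i \<in> G then 0 else lookup m (Z G))"
    for i
  proof (rule sum.mono_neutral_right)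
    show "\<forall>G\<in>facets \<Delta> - {F}. (if i \<in> G then 0 else lookup m (Z G)) = 0"
      using F(3) by (metis DiffD1 DiffD2 singletonI)
  qed (use F(1) facets_finite[OF \<Delta>] in auto)
  then have "y_exp \<Delta> m i = lookup m (Y i) + (if i \<in> F then 0 else 1)" for i
    using F(2) by (simp add: y_exp_def)
  moreover have "lookup m (Z G) = (if G = F then 1 else 0)" if "G \<in> facets \<Delta>" for G
    using F(2) F(3)[OF that] by auto
  ultimately show ?thesis using that F(1) by blast
qed

lemma t_exp_yz: "simplicial_complex n \<Delta> \<Longrightarrow> F \<in> facets \<Delta> \<Longrightarrow> t_exp \<Delta> (yz A F) = 1"
  using facets_finite[of n \<Delta>] by (simp add: t_exp_def lookup_yz)

lemma y_exp_yz:
  assumes "simplicial_complex n \<Delta>" "F \<in> facets \<Delta>" "finite A"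
  shows "y_exp \<Delta> (yz A F) i = (if i \<in> A then 1 else 0) + (if i \<in> F then 0 else 1)"
proof -
  have "(\<Sum>G\<in>facets \<Delta>. if i \<in> G then 0 else lookup (yz A F) (Z G))
      = (\<Sum>G\<in>{F}. if i \<in> G then 0 else lookup (yz A F) (Z G))"
    by (rule sum.mono_neutral_right) (use assms facets_finite[of n \<Delta>] in \<open>auto simp: lookup_yz\<close>)
  with assms(3) show ?thesis by (simp add: y_exp_def lookup_yz)
qed

lemma facet_finite: "simplicial_complex n \<Delta> \<Longrightarrow> F \<in> facets \<Delta> \<Longrightarrow> finite F"
  by (rule face_finite[OF _ facet_face])

text \<open>On \<open>F \<inter> G\<close> both exponents of \<open>y_i\<close> are 0, and everywhere else both are 1.\<close>

lemma same_image_b: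
  assumes "simplicial_complex n \<Delta>" "F \<in> facets \<Delta>" "G \<in> facets \<Delta>"
  shows "same_image \<Delta> (yz (F - G) F) (yz (G - F) G)"
  using assms facet_finite[OF assms(1)]
  by (auto simp: same_image_def lookup_yz t_exp_yz y_exp_yz)

text \<open>The exponents of the \<open>z_F\<close> are the only information that the image of a monomial loses.\<close>

lemma same_image_eqI:
  assumes "same_image \<Delta> m m'" "m \<in> monomials (T_vars n \<Delta>)" "m' \<in> monomials (T_vars n \<Delta>)"
    and Z: "\<And>F. F \<in> facets \<Delta> \<Longrightarrow> lookup m (Z F) = lookup m' (Z F)"
  shows "m = m'"
proof (rule poly_mapping_eqI)
  fix v
  show "lookup m v = lookup m' v"
  proof (cases v)
    case (Y i)
    have "(\<Sum>F\<in>facets \<Delta>. if i \<in> F then 0 else lookup m (Z F))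
        = (\<Sum>F\<in>facets \<Delta>. if i \<in> F then 0 else lookup m' (Z F))"
      by (rule sum.cong) (auto simp: Z)
    moreover have "y_exp \<Delta> m i = y_exp \<Delta> m' i" using assms(1) by (simp add: same_image_def)
    ultimately show ?thesis unfolding Y y_exp_def by linarith
  next
    case (Z F)
    show ?thesis
    proof (cases "F \<in> facets \<Delta>")
      case False
      then have "Z F \<notin> keys m" "Z F \<notin> keys m'"
        using assms(2,3) by (auto simp: monomials_def T_vars_def S_vars_def)
      then show ?thesis using Z by (simp add: in_keys_iff)
    qed (use Z assms(4) in simp)
  qed (use assms(1) in \<open>simp add: same_image_def\<close>)
qed

section \<open>Vanishing of $J_\Delta$ under the map\<close>

text \<open>A weight of this kind is a linear functional on the polynomials in the variables \<open>x_i\<close>, \<open>y_i\<close>, \<open>t\<close>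
  modulo the vanishing monomials. Hence the polynomials of $T$ killed by all of these weights are those whose
  image is 0 there, and this description avoids a second polynomial ring.\<close>

definition image_weight :: "nat set set \<Rightarrow> (var monomial \<Rightarrow> 'a::zero) \<Rightarrow> bool" where
  "image_weight \<Delta> f \<longleftrightarrow> (\<forall>m. vanishing \<Delta> m \<longrightarrow> f m = 0) \<and>
     (\<forall>m m'. same_image \<Delta> m m' \<longrightarrow> f m = f m')"

definition image_kernel :: "nat set set \<Rightarrow> var set \<Rightarrow> (var, 'a::comm_ring_1) mpoly set" where
  "image_kernel \<Delta> V = {p \<in> carrier (poly_ring V). \<forall>f. image_weight \<Delta> f \<longrightarrow> weigh f p = 0}"

text \<open>Images are multiplicative and vanishing monomials are closed under multiples; this makes
  the common kernel of the weights an ideal.\<close>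

lemma image_weight_shift:
  assumes "simplicial_complex n \<Delta>" "image_weight \<Delta> f"
  shows "image_weight \<Delta> (\<lambda>m. f (t + m))"
  using assms(2) vanishing_plus[OF assms(1)] same_image_plus unfolding image_weight_def by blast

lemma ideal_kernel:
  assumes \<Delta>: "simplicial_complex n \<Delta>"
  shows "ideal (image_kernel \<Delta> V :: (var, 'a::comm_ring_1) mpoly set) (poly_ring V)"
proof -
  interpret cring "poly_ring V :: (var, 'a) mpoly ring" by (rule cring_poly_ring)
  show ?thesis
  proof (rule ideal_poly_ringI)
    fix p q :: "(var, 'a) mpoly" assume "p \<in> image_kernel \<Delta> V" "q \<in> image_kernel \<Delta> V"
    then show "p + q \<in> image_kernel \<Delta> V"
      using a_closed[of p q] by (simp add: image_kernel_def weigh_add del: a_closed)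
  next
    fix p q :: "(var, 'a) mpoly" assume p: "p \<in> carrier (poly_ring V)" and q: "q \<in> image_kernel \<Delta> V"
    have "weigh f (p * q) = 0" if "image_weight \<Delta> f" for f :: "var monomial \<Rightarrow> 'a"
      using q image_weight_shift[OF \<Delta> that] by (intro weigh_mult_eq_0) (simp add: image_kernel_def)
    then show "p * q \<in> image_kernel \<Delta> V"
      using m_closed[OF p, of q] q by (simp add: image_kernel_def del: m_closed)
  qed (auto simp: image_kernel_def carrier_poly_ring)
qed

lemma carrier_poly_ring_mono:
  "V \<subseteq> W \<Longrightarrow> carrier (poly_ring V) \<subseteq> (carrier (poly_ring W) :: ('v, 'a::comm_ring_1) mpoly set)"
  by (fastforce simp: carrier_poly_ring monomials_def)

lemma kernel_mono:
  "V \<subseteq> W \<Longrightarrow> image_kernel \<Delta> V \<subseteq> (image_kernel \<Delta> W :: (var, 'a::comm_ring_1) mpoly set)"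
  using carrier_poly_ring_mono[of V W] by (auto simp: image_kernel_def)

lemma vanishing_in_kernel:
  assumes "p \<in> carrier (poly_ring V)" "\<And>m. m \<in> keys p \<Longrightarrow> vanishing \<Delta> m"
  shows "(p :: (var, 'a::comm_ring_1) mpoly) \<in> image_kernel \<Delta> V"
  using assms by (auto simp: image_kernel_def weigh_def image_weight_def intro!: sum.neutral)

lemma binomial_in_kernel:
  assumes "m \<in> monomials V" "m' \<in> monomials V" "same_image \<Delta> m m'"
  shows "(mono_poly m - mono_poly m' :: (var, 'a::comm_ring_1) mpoly) \<in> image_kernel \<Delta> V"
proof -
  have "mono_poly m - mono_poly m' \<in> carrier (poly_ring V :: (var, 'a) mpoly ring)"
    using Poly_Mapping.keys_diff[of "mono_poly m :: (var, 'a) mpoly" "mono_poly m'"] assms(1,2)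
    by (auto simp: carrier_poly_ring)
  then show ?thesis
    using assms(3) by (simp add: image_kernel_def weigh_minus image_weight_def)
qed

text \<open>The indicator of the fibre of \<open>m\<close> is an admissible weight, so the coefficients of \<open>p\<close> on this fibre
  add up to 0 and \<open>m\<close> cannot be alone in it.\<close>

lemma kernel_key:
  fixes p :: "(var, 'a::comm_ring_1) mpoly"
  assumes p: "p \<in> image_kernel \<Delta> V" and m: "m \<in> keys p" "\<not> vanishing \<Delta> m"
  shows "\<exists>m'\<in>keys p. m' \<noteq> m \<and> same_image \<Delta> m' m"
proof (rule ccontr)
  assume none: "\<not> ?thesis"
  define f :: "var monomial \<Rightarrow> 'a" where "f u = (if same_image \<Delta> u m then 1 else 0)" for u
  have "image_weight \<Delta> f"
    using m(2) same_image_vanishing same_image_sym same_image_trans unfolding image_weight_def f_def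
    by (smt (verit))
  then have "weigh f p = 0" using p by (simp add: image_kernel_def)
  moreover have "weigh f p = (\<Sum>u\<in>{m}. lookup p u * f u)"
    unfolding weigh_def by (rule sum.mono_neutral_right) (use m none in \<open>auto simp: f_def\<close>)
  ultimately show False using m(1) by (simp add: f_def same_image_def in_keys_iff)
qed

lemma vanishing_generators:
  assumes \<Delta>: "simplicial_complex n \<Delta>"
  shows "N \<subseteq> {1..n} \<Longrightarrow> N \<notin> \<Delta> \<Longrightarrow> vanishing \<Delta> (sqfree X N)"
    and "vanishing \<Delta> (Poly_Mapping.single (X i) 1 + Poly_Mapping.single (Y i) 1)"
    and "F \<in> facets \<Delta> \<Longrightarrow> i \<notin> F \<Longrightarrow>
      vanishing \<Delta> (Poly_Mapping.single (X i) 1 + Poly_Mapping.single (Z F) 1)"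
    and "F \<in> facets \<Delta> \<Longrightarrow> G \<in> facets \<Delta> \<Longrightarrow>
      vanishing \<Delta> (Poly_Mapping.single (Z F) 1 + Poly_Mapping.single (Z G) 1)"
proof -
  note fin = facets_finite[OF \<Delta>]
  show "vanishing \<Delta> (sqfree X N)" if "N \<subseteq> {1..n}" "N \<notin> \<Delta>"
  proof -
    have "{i. 0 < lookup (sqfree X N) (X i)} = N"
      using finite_subset[OF that(1)] by (auto simp: lookup_sqfree_X split: if_splits)
    then show ?thesis using that(2) by (simp add: vanishing_def)
  qed
  show "vanishing \<Delta> (Poly_Mapping.single (X i) 1 + Poly_Mapping.single (Y i) 1)"
    unfolding vanishing_def
    by (intro disjI2 disjI1 exI[of _ i])
      (simp add: Poly_Mapping.lookup_add lookup_single_var[unfolded One_nat_def] y_exp_def)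
  have t: "t_exp \<Delta> (Poly_Mapping.single (Z F) 1) = 1" if "F \<in> facets \<Delta>" for F
    using fin that by (simp add: t_exp_def lookup_single_var[unfolded One_nat_def])
  show "vanishing \<Delta> (Poly_Mapping.single (Z F) 1 + Poly_Mapping.single (Z G) 1)"
    if "F \<in> facets \<Delta>" "G \<in> facets \<Delta>"
    using t[OF that(1)] t[OF that(2)] by (simp add: vanishing_def t_exp_plus)
  show "vanishing \<Delta> (Poly_Mapping.single (X i) 1 + Poly_Mapping.single (Z F) 1)"
    if "F \<in> facets \<Delta>" "i \<notin> F"
  proof -
    have "0 < y_exp \<Delta> (yz {} F) i" using y_exp_yz[OF \<Delta> that(1), of "{}" i] that(2) by simp
    then show ?thesis
      unfolding vanishing_def
      by (intro disjI2 disjI1 exI[of _ i])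
        (simp add: Poly_Mapping.lookup_add lookup_single_var[unfolded One_nat_def] y_exp_plus yz_def sqfree_def)
  qed
qed

lemma monomials_pair:
  "u \<in> V \<Longrightarrow> v \<in> V \<Longrightarrow> Poly_Mapping.single u 1 + Poly_Mapping.single v 1 \<in> monomials V"
  by (intro monomials_plus monomials_single)

lemma indet_mult: "indet u * indet v = mono_poly (Poly_Mapping.single u 1 + Poly_Mapping.single v 1)"
  by (simp add: indet_def mono_poly_mult)

text \<open>All generators of $J_\Delta$ are vanishing monomials or differences of monomials with equal images. In
  the square of \<open>(z_F : F)\<close> every monomial has \<open>t\<close>-exponent at least 2.\<close>

lemma J_ideal_props:
  fixes n \<Delta>
  defines "J \<equiv> (J_ideal n \<Delta> :: (var, 'a::field) mpoly set)" and "V \<equiv> T_vars n \<Delta>"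
  assumes \<Delta>: "simplicial_complex n \<Delta>"
  shows "J \<subseteq> image_kernel \<Delta> V"
    and "N \<subseteq> {1..n} \<Longrightarrow> N \<notin> \<Delta> \<Longrightarrow> mono_poly (sqfree X N) \<in> J"
    and "i \<in> {1..n} \<Longrightarrow> mono_poly (Poly_Mapping.single (X i) 1 + Poly_Mapping.single (Y i) 1) \<in> J"
    and "F \<in> facets \<Delta> \<Longrightarrow> i \<in> {1..n} - F \<Longrightarrow>
      mono_poly (Poly_Mapping.single (X i) 1 + Poly_Mapping.single (Z F) 1) \<in> J"
    and "F \<in> facets \<Delta> \<Longrightarrow> G \<in> facets \<Delta> \<Longrightarrow>
      mono_poly (Poly_Mapping.single (Z F) 1 + Poly_Mapping.single (Z G) 1) \<in> J"
    and "F \<in> facets \<Delta> \<Longrightarrow> G \<in> facets \<Delta> \<Longrightarrow> F \<noteq> G \<Longrightarrow> b_poly F G \<in> J"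
proof -
  let ?T = "poly_ring V :: (var, 'a) mpoly ring"
  let ?S = "poly_ring (S_vars n) :: (var, 'a) mpoly ring"
  let ?x = "poly_ring (x_vars n) :: (var, 'a) mpoly ring"
  let ?nf = "{\<Prod>i\<in>F. indet (X i) |F. F \<subseteq> {1..n} \<and> F \<notin> \<Delta>} :: (var, 'a) mpoly set"
  let ?xy = "{indet (X i) * indet (Y i) |i. i \<in> {1..n}} :: (var, 'a) mpoly set"
  let ?xz = "{indet (X i) * indet (Z F) |i F. F \<in> facets \<Delta> \<and> i \<in> {1..n} - F} :: (var, 'a) mpoly set"
  let ?b = "{b_poly F G |F G. F \<in> facets \<Delta> \<and> G \<in> facets \<Delta> \<and> F \<noteq> G} :: (var, 'a) mpoly set"
  let ?z = "{indet (Z F) |F. F \<in> facets \<Delta>} :: (var, 'a) mpoly set"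
  let ?SR = "SR_ideal n \<Delta> :: (var, 'a) mpoly set"
  let ?\<Gamma> = "Gamma_ideal n \<Delta> :: (var, 'a) mpoly set"
  let ?Zs = "Idl\<^bsub>?T\<^esub> ?z"
  note K = ideal_kernel[OF \<Delta>, where ?'a = 'a]
  note kerI = vanishing_in_kernel[OF mono_poly_carrier]
  have XS: "X i \<in> S_vars n" "Y i \<in> S_vars n" if "i \<in> {1..n}" for i using that by (auto simp: S_vars_def)
  have ST: "S_vars n \<subseteq> V" and xS: "x_vars n \<subseteq> S_vars n" by (auto simp: V_def T_vars_def S_vars_def x_vars_def)
  have ZT: "Z F \<in> V" if "F \<in> facets \<Delta>" for F using that by (auto simp: V_def T_vars_def)
  have fac: "F \<subseteq> {1..n}" if "F \<in> facets \<Delta>" for F by (rule face_subset[OF \<Delta> facet_face[OF that]])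
  have carr: "image_kernel \<Delta> W \<subseteq> carrier (poly_ring W :: (var, 'a) mpoly ring)" for W
    by (auto simp: image_kernel_def)

  have "mono_poly (sqfree X N) \<in> (image_kernel \<Delta> (x_vars n) :: (var, 'a) mpoly set)"
    if "N \<subseteq> {1..n}" "N \<notin> \<Delta>" for N
    using that vanishing_generators(1)[OF \<Delta> that]
    by (intro kerI monomials_sqfree) (auto simp: x_vars_def simp del: One_nat_def)
  then have nf: "?nf \<subseteq> image_kernel \<Delta> (x_vars n)"
    unfolding prod_indet by blast
  then have SR: "?SR \<subseteq> image_kernel \<Delta> (x_vars n)"
    unfolding SR_ideal_def by (rule genideal_poly_ring_subset[OF K])
  have SR_S: "?SR \<subseteq> image_kernel \<Delta> (S_vars n)" using SR kernel_mono[OF xS] by blast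
  have xy: "?xy \<subseteq> image_kernel \<Delta> (S_vars n)"
    using XS vanishing_generators(2)[OF \<Delta>]
    by (auto simp: indet_mult simp del: One_nat_def intro!: kerI monomials_pair)
  note idl_S = genideal_poly_ring_ideal[OF order_trans[OF SR_S carr]]
    genideal_poly_ring_ideal[OF order_trans[OF xy carr]]
  have \<Gamma>: "?\<Gamma> \<subseteq> image_kernel \<Delta> (S_vars n)"
    unfolding Gamma_ideal_def by (intro ideal_sum_subset K genideal_poly_ring_subset SR_S xy)
  have \<Gamma>_T: "?\<Gamma> \<subseteq> image_kernel \<Delta> V" using \<Gamma> kernel_mono[OF ST] by blast
  have xz: "?xz \<subseteq> image_kernel \<Delta> V"
    using XS ST ZT vanishing_generators(3)[OF \<Delta>]
    by (auto simp: indet_mult simp del: One_nat_def intro!: kerI monomials_pair)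
  have b: "?b \<subseteq> image_kernel \<Delta> V"
  proof -
    have "b_poly F G \<in> (image_kernel \<Delta> V :: (var, 'a) mpoly set)" if "F \<in> facets \<Delta>" "G \<in> facets \<Delta>" for F G
      unfolding b_poly_yz V_def using fac[OF that(1)] fac[OF that(2)] that
      by (intro binomial_in_kernel same_image_b[OF \<Delta>] monomials_yz) auto
    then show ?thesis by blast
  qed
  have z: "?z \<subseteq> carrier ?T"
    using ZT by (auto intro!: indet_carrier)
  \<comment> \<open>Contains the ideal generated by the \<open>z_F\<close>.\<close>
  define D where "D = {p \<in> carrier ?T. \<forall>m\<in>keys p. 1 \<le> t_exp \<Delta> m}"
  have D: "ideal D ?T"
  proof -
    interpret cring ?T by (rule cring_poly_ring)
    show ?thesis
    proof (rule ideal_poly_ringI)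
      fix p q :: "(var, 'a) mpoly" assume "p \<in> D" "q \<in> D"
      then show "p + q \<in> D"
        using Poly_Mapping.keys_add[of p q] a_closed[of p q] unfolding D_def
        by (auto simp del: a_closed)
    next
      fix p q :: "(var, 'a) mpoly" assume p: "p \<in> carrier ?T" and q: "q \<in> D"
      have "1 \<le> t_exp \<Delta> m" if m: "m \<in> keys (p * q)" for m
      proof -
        obtain u v where uv: "m = u + v" "v \<in> keys q"
          using m Poly_Mapping.keys_mult[of p q] by auto
        then have "1 \<le> t_exp \<Delta> v" using q by (simp add: D_def)
        then show ?thesis by (simp add: uv(1) t_exp_plus)
      qed
      then show "p * q \<in> D" using m_closed[OF p, of q] q by (simp add: D_def del: m_closed)
    qed (auto simp: D_def carrier_poly_ring)
  qed
  have t1: "t_exp \<Delta> (Poly_Mapping.single (Z F) 1) = 1" if "F \<in> facets \<Delta>" for F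
    using t_exp_yz[OF \<Delta> that, of "{}"] by (simp add: yz_def sqfree_def)
  have Zs_D: "?Zs \<subseteq> D"
    by (rule genideal_poly_ring_subset[OF D]) (use z t1 in \<open>auto simp: D_def indet_def\<close>)
  have Zs: "ideal ?Zs ?T" by (rule genideal_poly_ring_ideal[OF z])
  have ZZ_ker: "ideal_prod ?T ?Zs ?Zs \<subseteq> image_kernel \<Delta> V"
  proof
    fix s assume "s \<in> ideal_prod ?T ?Zs ?Zs"
    then show "s \<in> image_kernel \<Delta> V"
    proof (induction rule: ideal_prod.induct)
      case (prod p q)
      then have pq: "p \<in> D" "q \<in> D" using Zs_D by auto
      interpret cring ?T by (rule cring_poly_ring)
      show ?case
      proof (rule vanishing_in_kernel)
        show "p \<otimes>\<^bsub>?T\<^esub> q \<in> carrier ?T" using pq unfolding D_def by blast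
        fix m assume "m \<in> keys (p \<otimes>\<^bsub>?T\<^esub> q)"
        then obtain u v where "m = u + v" "u \<in> keys p" "v \<in> keys q"
          using Poly_Mapping.keys_mult[of p q] by auto
        moreover from this have "1 \<le> t_exp \<Delta> u" "1 \<le> t_exp \<Delta> v" using pq by (auto simp: D_def)
        ultimately show "vanishing \<Delta> m" by (simp add: vanishing_def t_exp_plus)
      qed
    next
      case (sum p q)
      then show ?case using additive_subgroup.a_closed[OF ideal.axioms(1)[OF K]] by blast
    qed
  qed
  have ZZ: "ideal (ideal_prod ?T ?Zs ?Zs) ?T"
    by (rule ring.ideal_prod_is_ideal[OF ring_poly_ring Zs Zs])
  have J: "J = Idl\<^bsub>?T\<^esub> ?\<Gamma> <+>\<^bsub>?T\<^esub> Idl\<^bsub>?T\<^esub> ?xz <+>\<^bsub>?T\<^esub> Idl\<^bsub>?T\<^esub> ?b <+>\<^bsub>?T\<^esub> ideal_prod ?T ?Zs ?Zs"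
    by (simp add: J_def J_ideal_def V_def Let_def)
  show "J \<subseteq> image_kernel \<Delta> V"
    unfolding J by (intro ideal_sum_subset K genideal_poly_ring_subset \<Gamma>_T xz b ZZ_ker)
  note idl_T = genideal_poly_ring_ideal[OF order_trans[OF \<Gamma>_T carr]]
    genideal_poly_ring_ideal[OF order_trans[OF xz carr]]
    genideal_poly_ring_ideal[OF order_trans[OF b carr]]
  note sum1 = ideal_sum_poly_ring[OF idl_T(1,2)]
  note sum2 = ideal_sum_poly_ring[OF sum1(1) idl_T(3)]
  note sum3 = ideal_sum_poly_ring[OF sum2(1) ZZ]
  have \<Gamma>_J: "?\<Gamma> \<subseteq> J"
    unfolding J using sum1(2) sum2(2) sum3(2) genideal_poly_ring_self[OF order_trans[OF \<Gamma>_T carr]]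
    by blast
  have xz_J: "?xz \<subseteq> J"
    unfolding J using sum1(3) sum2(2) sum3(2) genideal_poly_ring_self[OF order_trans[OF xz carr]]
    by blast
  have b_J: "?b \<subseteq> J"
    unfolding J using sum2(3) sum3(2) genideal_poly_ring_self[OF order_trans[OF b carr]] by blast
  have nf_J: "?nf \<subseteq> J"
  proof -
    have "?nf \<subseteq> ?SR"
      unfolding SR_ideal_def using genideal_poly_ring_self[OF order_trans[OF nf carr]] by blast
    also have "\<dots> \<subseteq> ?\<Gamma>"
      unfolding Gamma_ideal_def
      using ideal_sum_poly_ring(2)[OF idl_S] genideal_poly_ring_self[OF order_trans[OF SR_S carr]]
      by blast
    finally show ?thesis using \<Gamma>_J by blast
  qed
  have xy_J: "?xy \<subseteq> J"
  proof -
    have "?xy \<subseteq> ?\<Gamma>"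
      unfolding Gamma_ideal_def
      using ideal_sum_poly_ring(3)[OF idl_S] genideal_poly_ring_self[OF order_trans[OF xy carr]]
      by blast
    then show ?thesis using \<Gamma>_J by blast
  qed
  show "mono_poly (sqfree X N) \<in> J" if "N \<subseteq> {1..n}" "N \<notin> \<Delta>"
    using nf_J that unfolding prod_indet by blast
  show "mono_poly (Poly_Mapping.single (X i) 1 + Poly_Mapping.single (Y i) 1) \<in> J" if "i \<in> {1..n}"
    using xy_J that unfolding indet_mult by blast
  show "mono_poly (Poly_Mapping.single (X i) 1 + Poly_Mapping.single (Z F) 1) \<in> J"
    if "F \<in> facets \<Delta>" "i \<in> {1..n} - F"
    using xz_J that unfolding indet_mult by blast
  show "b_poly F G \<in> J" if "F \<in> facets \<Delta>" "G \<in> facets \<Delta>" "F \<noteq> G"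
    using b_J that by blast
  show "mono_poly (Poly_Mapping.single (Z F) 1 + Poly_Mapping.single (Z G) 1) \<in> J"
    if "F \<in> facets \<Delta>" "G \<in> facets \<Delta>"
  proof -
    have "indet (Z F) \<in> ?Zs" "indet (Z G) \<in> ?Zs"
      using genideal_poly_ring_self[OF z] that by blast+
    from ideal_prod.prod[OF this, of ?T] have "indet (Z F) * indet (Z G) \<in> ideal_prod ?T ?Zs ?Zs"
      by simp
    then have "indet (Z F) * indet (Z G) \<in> J" unfolding J by (rule subsetD[OF sum3(3)])
    then show ?thesis unfolding indet_mult .
  qed
qed

section \<open>From a quadratic Groebner basis to a shelling\<close>

lemma yz_plus:
  assumes "finite A" "finite B" "A \<inter> B = {}"
  shows "yz A F + sqfree Y B = yz (A \<union> B) F"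
  using assms by (simp add: yz_def sqfree_def sum.union_disjoint algebra_simps)

lemma keys_binomial:
  assumes "a \<noteq> b"
  shows "keys (mono_poly a - mono_poly b :: ('v, 'a::comm_ring_1) mpoly) = {a, b}"
  using assms by (auto simp: in_keys_iff Poly_Mapping.lookup_minus mono_poly_def
      Poly_Mapping.lookup_single when_def split: if_splits)

lemma yz_neq: "F \<noteq> G \<Longrightarrow> yz A F \<noteq> yz B G"
  using lookup_yz(3)[of A F F] lookup_yz(3)[of B G F] by auto

lemma keys_b_poly:
  "F \<noteq> G \<Longrightarrow> keys (b_poly F G :: (var, 'a::field) mpoly) = {yz (F - G) F, yz (G - F) G}"
  unfolding b_poly_yz by (rule keys_binomial) (rule yz_neq)

text \<open>Multiplication by \<open>y^(F \<inter> G)\<close> turns the two monomials of \<open>b_poly F G\<close> into \<open>y^F z_F\<close> and \<open>y^G z_G\<close>.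
  Comparing the latter gives a single linear order on the facets that governs all leading monomials.\<close>

lemma term_order_yz:
  assumes \<Delta>: "simplicial_complex n \<Delta>" and r: "term_order (T_vars n \<Delta>) r"
    and F: "F \<in> facets \<Delta>" and G: "G \<in> facets \<Delta>"
    and less: "(yz (G - F) G, yz (F - G) F) \<in> r"
  shows "(yz G G, yz F F) \<in> r"
proof -
  have fin: "finite F" "finite G" using facet_finite[OF \<Delta>] F G by auto
  have "sqfree Y (F \<inter> G) \<in> monomials (T_vars n \<Delta>)"
    using face_subset[OF \<Delta> facet_face[OF F]]
    by (intro monomials_sqfree) (auto simp: T_vars_def S_vars_def simp del: One_nat_def)
  with less r have "(yz (G - F) G + sqfree Y (F \<inter> G), yz (F - G) F + sqfree Y (F \<inter> G)) \<in> r"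
    unfolding term_order_def by blast
  moreover have "yz (G - F) G + sqfree Y (F \<inter> G) = yz G G" "yz (F - G) F + sqfree Y (F \<inter> G) = yz F F"
  proof -
    have "(G - F) \<inter> (F \<inter> G) = {}" "(F - G) \<inter> (F \<inter> G) = {}"
      "(G - F) \<union> (F \<inter> G) = G" "(F - G) \<union> (F \<inter> G) = F" by blast+
    then show "yz (G - F) G + sqfree Y (F \<inter> G) = yz G G" "yz (F - G) F + sqfree Y (F \<inter> G) = yz F F"
      using fin by (simp_all add: yz_plus)
  qed
  ultimately show ?thesis by simp
qed

text \<open>Monomials with \<open>t\<close>-exponent 0 are determined by their images, and from \<open>t\<close>-exponent 2 on they vanish.\<close>

lemma t_exp_eq_1:
  assumes \<Delta>: "simplicial_complex n \<Delta>" and m: "m \<in> monomials (T_vars n \<Delta>)" "m' \<in> monomials (T_vars n \<Delta>)"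
    and same: "same_image \<Delta> m' m" and neq: "m' \<noteq> m" and nv: "\<not> vanishing \<Delta> m"
  shows "t_exp \<Delta> m = 1" "t_exp \<Delta> m' = 1"
proof -
  have "t_exp \<Delta> m \<noteq> 0"
  proof
    assume "t_exp \<Delta> m = 0"
    moreover from this have "t_exp \<Delta> m' = 0" using same by (simp add: same_image_def)
    ultimately have "m' = m"
      using facets_finite[OF \<Delta>] by (intro same_image_eqI[OF same m(2,1)]) (simp add: t_exp_def)
    with neq show False ..
  qed
  with nv show "t_exp \<Delta> m = 1" by (simp add: vanishing_def)
  with same show "t_exp \<Delta> m' = 1" by (simp add: same_image_def)
qed

lemma not_vanishing_yz:
  assumes "simplicial_complex n \<Delta>" "F \<in> facets \<Delta>"
  shows "\<not> vanishing \<Delta> (yz A F)"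
  using t_exp_yz[OF assms, of A] assms(1) by (auto simp: vanishing_def lookup_yz simplicial_complex_def)

text \<open>A nonvanishing leading monomial \<open>q\<close> of a member of $J_\Delta$ comes with a smaller monomial \<open>q'\<close> of the
  same image. If \<open>q\<close> divides \<open>y^A z_F\<close>, then \<open>q = y^B z_F\<close> with \<open>B\<close> contained in \<open>A\<close>, and \<open>q'\<close> contains
  \<open>z_H\<close> for a facet \<open>H \<noteq> F\<close>; equality of the images forces \<open>F - H\<close> into \<open>B\<close>. Since \<open>q\<close> has degree at
  most 2, \<open>B\<close> is a single vertex \<open>v\<close>, and \<open>q\<close>, \<open>q'\<close> are the two monomials of \<open>b_poly F H\<close>. The degree of
  \<open>q\<close> is only bounded by that of \<open>g\<close>, as the term order need not refine the degree.\<close>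

lemma quadratic_divisor_of_yz:
  fixes n \<Delta> r and g :: "(var, 'a::field) mpoly"
  defines "V \<equiv> T_vars n \<Delta>" and "q \<equiv> leading_monomial r g"
  assumes \<Delta>: "simplicial_complex n \<Delta>"
    and r: "linear_order_on (monomials V) r"
    and g: "g \<in> image_kernel \<Delta> V" "g \<noteq> 0" "poly_degree g = 2"
    and F: "F \<in> facets \<Delta>" and fin: "finite A"
    and q_dvd: "\<And>v. lookup q v \<le> lookup (yz A F) v"
  shows "\<exists>v\<in>A. \<exists>H\<in>facets \<Delta>. F - H = {v} \<and> (yz (H - F) H, yz (F - H) F) \<in> r"
proof -
  have carr: "g \<in> carrier (poly_ring V)" using g(1) by (simp add: image_kernel_def)
  note lead = leading_monomial_props[OF r carr g(2), folded q_def]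
  have nv: "\<not> vanishing \<Delta> q"
    using not_vanishing_yz[OF \<Delta> F, of A] vanishing_plus[OF \<Delta>, of q "yz A F - q"]
      divides_monomial(1)[of q "yz A F", OF q_dvd] by auto
  obtain q' where q': "q' \<in> keys g" "q' \<noteq> q" "same_image \<Delta> q' q"
    using kernel_key[OF g(1) lead(1) nv] by blast
  have q_mon: "q \<in> monomials V" and q'_mon: "q' \<in> monomials V"
    using keys_carrier[OF carr] lead(1) q'(1) by auto
  note t1 = t_exp_eq_1[OF \<Delta> q_mon[unfolded V_def] q'_mon[unfolded V_def] q'(3,2) nv]
  obtain F' where F': "F' \<in> facets \<Delta>"
      "\<And>G. G \<in> facets \<Delta> \<Longrightarrow> lookup q (Z G) = (if G = F' then 1 else 0)"
      "\<And>i. y_exp \<Delta> q i = lookup q (Y i) + (if i \<in> F' then 0 else 1)"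
    using t_exp_1[OF \<Delta> t1(1)] by metis
  have "lookup q (Z F') \<le> lookup (yz A F) (Z F')" by (rule q_dvd)
  then have "F' = F" using F'(2)[OF F'(1)] by (auto simp: lookup_yz split: if_splits)
  note F'(2,3)[unfolded this]
  then have qZ: "\<And>G. G \<in> facets \<Delta> \<Longrightarrow> lookup q (Z G) = (if G = F then 1 else 0)"
    and qY: "\<And>i. y_exp \<Delta> q i = lookup q (Y i) + (if i \<in> F then 0 else 1)" by blast+
  obtain H where H: "H \<in> facets \<Delta>"
      "\<And>G. G \<in> facets \<Delta> \<Longrightarrow> lookup q' (Z G) = (if G = H then 1 else 0)"
      "\<And>i. y_exp \<Delta> q' i = lookup q' (Y i) + (if i \<in> H then 0 else 1)"
    using t_exp_1[OF \<Delta> t1(2)] by metis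
  have "H \<noteq> F"
    using same_image_eqI[OF q'(3) q'_mon[unfolded V_def] q_mon[unfolded V_def]] qZ H(2) q'(2) by auto
  then obtain v where v: "v \<in> F" "v \<notin> H" using facet_subset_eq[OF F H(1)] by blast
  have y_eq: "lookup q (Y i) + (if i \<in> F then 0 else 1) = lookup q' (Y i) + (if i \<in> H then 0 else 1)" for i
    using q'(3) qY[of i] H(3)[of i] by (simp add: same_image_def)
  have qv: "0 < lookup q (Y v)" using y_eq[of v] v by simp
  have le1: "lookup q (Y i) \<le> (if i \<in> A then 1 else 0)" for i
    using q_dvd[of "Y i"] lookup_yz(2)[OF fin] by simp
  have "mono_degree q \<le> poly_degree g"
    unfolding poly_degree_def by (rule Max_ge) (use lead(1) in auto)
  then have "mono_degree q \<le> 2" using g(3) by simp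
  \<comment> \<open>Otherwise \<open>y_v y_i z_F\<close>, of degree 3, would divide \<open>q\<close>.\<close>
  have q0: "lookup q (Y i) = 0" if "i \<noteq> v" for i
  proof (rule ccontr)
    assume i: "lookup q (Y i) \<noteq> 0"
    have "lookup (yz {v, i} F) w \<le> lookup q w" for w
    proof (cases w)
      case (Y k)
      then show ?thesis using i qv by (auto simp: lookup_yz Suc_le_eq)
    next
      case (Z G)
      then show ?thesis using qZ[OF F] by (auto simp: lookup_yz)
    qed (auto simp: lookup_yz)
    from mono_degree_mono[OF this] have "mono_degree (yz {v, i} F) \<le> mono_degree q" .
    then show False using \<open>mono_degree q \<le> 2\<close> that by (simp add: mono_degree_yz)
  qed
  have "F - {v} \<subseteq> H"
  proof
    fix i assume "i \<in> F - {v}"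
    then show "i \<in> H" using y_eq[of i] q0[of i] by (cases "i \<in> H") auto
  qed
  then have FH: "F - H = {v}" using v by blast
  have "v \<in> A" using qv le1[of v] by (auto split: if_splits)
  moreover have "q = yz (F - H) F"
  proof (rule poly_mapping_eqI)
    fix w
    show "lookup q w = lookup (yz (F - H) F) w"
    proof (cases w)
      case (X i)
      then show ?thesis using q_dvd[of w] by (simp add: lookup_yz)
    next
      case (Y i)
      then show ?thesis using q0[of i] le1[of v] qv \<open>v \<in> A\<close> by (auto simp: lookup_yz FH)
    next
      case (Z G)
      then show ?thesis using q_dvd[of w] qZ[OF F] by (cases "G = F") (auto simp: lookup_yz)
    qed
  qed
  moreover have "q' = yz (H - F) H"
  proof (rule same_image_eqI)
    show "same_image \<Delta> q' (yz (H - F) H)"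
      using q'(3) same_image_b[OF \<Delta> F H(1)] same_image_trans \<open>q = yz (F - H) F\<close> by blast
    show "q' \<in> monomials (T_vars n \<Delta>)" using q'_mon by (simp add: V_def)
    show "yz (H - F) H \<in> monomials (T_vars n \<Delta>)"
      using H(1) face_subset[OF \<Delta> facet_face[OF H(1)]] by (intro monomials_yz) auto
  qed (simp add: H(2) lookup_yz)
  ultimately show ?thesis
    using lead(2)[OF q'(1)] FH H(1) by (intro bexI[of _ v] bexI[of _ H]) simp_all
qed

text \<open>List the facets by increasing \<open>y^F z_F\<close>. For \<open>E\<close> before \<open>F\<close> the leading monomial of \<open>b_poly F E\<close> is
  \<open>y^(F-E) z_F\<close>, and a quadratic leading monomial dividing it yields the required vertex \<open>v\<close> and facet
  \<open>H\<close>, which precedes \<open>F\<close>.\<close>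

lemma shellable_if_quadratic:
  fixes G :: "(var, 'a::field) mpoly set"
  assumes \<Delta>: "simplicial_complex n \<Delta>" and pure: "pure_complex \<Delta>"
    and r: "term_order (T_vars n \<Delta>) r"
    and gb: "groebner_basis (T_vars n \<Delta>) r (J_ideal n \<Delta>) G"
    and quadratic: "\<forall>g\<in>G. poly_degree g = 2"
  shows "shellable n \<Delta>"
proof -
  let ?V = "T_vars n \<Delta>"
  let ?J = "J_ideal n \<Delta> :: (var, 'a) mpoly set"
  have lin: "linear_order_on (monomials ?V) r" using r by (simp add: term_order_def)
  note J = J_ideal_props[OF \<Delta>, where ?'a = 'a]
  have J_carr: "?J \<subseteq> carrier (poly_ring ?V)" using J(1) by (auto simp: image_kernel_def)
  have yz_mon: "yz A F \<in> monomials ?V" if "F \<in> facets \<Delta>" "A \<subseteq> F" for A F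
    using that face_subset[OF \<Delta> facet_face[OF that(1)]] by (intro monomials_yz) auto
  obtain Fs where Fs: "distinct Fs" "set Fs = facets \<Delta>"
      "sorted_wrt (\<lambda>E F. (yz E E, yz F F) \<in> r) Fs"
    using ex_sorted_list[OF lin facets_finite[OF \<Delta>], of "\<lambda>F. yz F F"] yz_mon by blast
  have facet: "Fs ! i \<in> facets \<Delta>" if "i < length Fs" for i
    using nth_mem[OF that] unfolding Fs(2) .
  have "\<exists>k<j. \<exists>v\<in>Fs ! j. v \<notin> Fs ! i \<and> Fs ! j - {v} \<subseteq> Fs ! k" if ij: "i < j" "j < length Fs" for i j
  proof -
    define F where "F = Fs ! j"
    define E where "E = Fs ! i"
    have F: "F \<in> facets \<Delta>" and E: "E \<in> facets \<Delta>" and "E \<noteq> F"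
      using facet ij Fs(1) by (auto simp: F_def E_def nth_eq_iff_index_eq)
    have EF: "(yz E E, yz F F) \<in> r"
      using sorted_wrt_nth_less[OF Fs(3) ij] by (simp add: E_def F_def)
    have lead: "(yz (E - F) E, yz (F - E) F) \<in> r"
    proof (rule ccontr)
      assume "(yz (E - F) E, yz (F - E) F) \<notin> r"
      then have "(yz (F - E) F, yz (E - F) E) \<in> r"
        using lin yz_mon[OF F, of "F - E"] yz_mon[OF E, of "E - F"]
          yz_neq[OF \<open>E \<noteq> F\<close>, of "E - F" "F - E"]
        unfolding linear_order_on_def total_on_def by (metis Diff_subset)
      from term_order_yz[OF \<Delta> r E F this] have "yz E E = yz F F"
        using linear_order_antisym[OF lin EF] by blast
      then show False using yz_neq[OF \<open>E \<noteq> F\<close>] by blast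
    qed
    let ?b = "b_poly F E :: (var, 'a) mpoly"
    have keys_b: "keys ?b = {yz (F - E) F, yz (E - F) E}" using keys_b_poly \<open>E \<noteq> F\<close> by blast
    have lm: "leading_monomial r ?b = yz (F - E) F"
      by (rule leading_monomial_eqI[OF lin])
        (use keys_b lead lin yz_mon[OF F, of "F - E"] in \<open>auto simp: order_on_defs refl_on_def\<close>)
    have "?b \<in> ?J" by (rule J(6)[OF F E]) (use \<open>E \<noteq> F\<close> in blast)
    moreover have "?b \<noteq> 0" using keys_b by auto
    ultimately obtain g where g: "g \<in> G" "g \<noteq> 0"
        "\<And>v. lookup (leading_monomial r g) v \<le> lookup (yz (F - E) F) v"
      using gb unfolding groebner_basis_iff[OF lin J_carr] lm[symmetric] by blast
    have "g \<in> image_kernel \<Delta> ?V" using g(1) gb J(1) unfolding groebner_basis_def by blast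
    moreover have "poly_degree g = 2" using g(1) quadratic by blast
    moreover have "finite (F - E)" using facet_finite[OF \<Delta> F] by simp
    ultimately obtain v H where vH: "v \<in> F - E" "H \<in> facets \<Delta>" "F - H = {v}"
        "(yz (H - F) H, yz (F - H) F) \<in> r"
      using quadratic_divisor_of_yz[OF \<Delta> lin _ g(2) _ F _ g(3)] by blast
    have HF: "(yz H H, yz F F) \<in> r" by (rule term_order_yz[OF \<Delta> r F vH(2,4)])
    have "H \<noteq> F" using vH(3) by blast
    obtain k where k: "k < length Fs" "H = Fs ! k" using vH(2) Fs(2) by (metis in_set_conv_nth)
    have "k < j"
    proof (rule ccontr)
      assume "\<not> k < j"
      then have "j < k" using \<open>H \<noteq> F\<close> k(2) F_def by (metis linorder_neqE_nat)
      then have "(yz F F, yz H H) \<in> r"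
        using sorted_wrt_nth_less[OF Fs(3) _ k(1)] by (simp add: F_def k(2))
      then have "yz H H = yz F F" using linear_order_antisym[OF lin HF] by blast
      then show False using yz_neq[OF \<open>H \<noteq> F\<close>] by blast
    qed
    then show ?thesis using vH(1,3) k(2) unfolding F_def E_def by blast
  qed
  then show ?thesis unfolding shellable_iff[OF \<Delta> pure] using Fs(1,2) by blast
qed

section \<open>From a shelling to a quadratic Groebner basis\<close>

text \<open>The variables \<open>z_F\<close> of later facets are larger, and they are compared before all other variables.\<close>

lemma lex_le_facets:
  assumes dist: "distinct Fs" and ij: "i < j" "j < length Fs"
    and a: "\<And>G. G \<in> set Fs \<Longrightarrow> lookup a (Z G) = (if G = Fs ! i then 1 else 0)"
    and b: "\<And>G. G \<in> set Fs \<Longrightarrow> lookup b (Z G) = (if G = Fs ! j then 1 else 0)"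
  shows "lex_le (map Z (rev Fs) @ ws) a b"
proof -
  have Fs: "Fs = take j Fs @ Fs ! j # drop (Suc j) Fs" using ij(2) by (rule id_take_nth_drop)
  have rev: "map Z (rev Fs) = map Z (rev (drop (Suc j) Fs)) @ Z (Fs ! j) # map Z (rev (take j Fs))"
    by (subst Fs) simp
  have "distinct (take j Fs @ Fs ! j # drop (Suc j) Fs)" using dist Fs by simp
  moreover have "Fs ! i \<in> set (take j Fs)" using ij by (auto simp: in_set_conv_nth intro!: exI[of _ i])
  ultimately have "Fs ! i \<notin> set (drop (Suc j) Fs)" "Fs ! j \<notin> set (drop (Suc j) Fs)" by auto
  then have "lookup a (Z G) = lookup b (Z G)" if "G \<in> set (drop (Suc j) Fs)" for G
    using that a[of G] b[of G] in_set_dropD[OF that] by auto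
  then have "lex_le (map Z (rev Fs) @ ws) a b
      \<longleftrightarrow> lex_le (Z (Fs ! j) # map Z (rev (take j Fs)) @ ws) a b"
    unfolding rev append_assoc append_Cons by (intro lex_le_append) auto
  moreover have "lookup a (Z (Fs ! j)) = 0" "lookup b (Z (Fs ! j)) = 1"
    using a[of "Fs ! j"] b[of "Fs ! j"] ij dist by (auto simp: nth_eq_iff_index_eq)
  ultimately show ?thesis by simp
qed

lemma pair_dvd:
  fixes m :: "'v monomial"
  assumes "0 < lookup m u" "0 < lookup m v" "u = v \<Longrightarrow> 2 \<le> lookup m u"
  shows "lookup (Poly_Mapping.single u 1 + Poly_Mapping.single v 1) w \<le> lookup m w"
  using assms by (auto simp: Poly_Mapping.lookup_add Poly_Mapping.lookup_single when_def)

text \<open>A monomial of degree 2 is given by a pair of variables.\<close>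

definition quadratic_vanishing :: "nat \<Rightarrow> nat set set \<Rightarrow> (var \<times> var) set" where
  "quadratic_vanishing n \<Delta> =
     {(X i, X j) |i j. i \<in> {1..n} \<and> j \<in> {1..n} \<and> i \<noteq> j \<and> {i, j} \<notin> \<Delta>} \<union>
     {(X i, Y i) |i. i \<in> {1..n}} \<union>
     {(X i, Z F) |i F. F \<in> facets \<Delta> \<and> i \<in> {1..n} - F} \<union>
     {(Z F, Z G) |F G. F \<in> facets \<Delta> \<and> G \<in> facets \<Delta>}"

lemma quadratic_vanishing_subset: "quadratic_vanishing n \<Delta> \<subseteq> T_vars n \<Delta> \<times> T_vars n \<Delta>"
  unfolding quadratic_vanishing_def T_vars_def S_vars_def by blast

lemma quadratic_vanishing_in_J:
  assumes \<Delta>: "simplicial_complex n \<Delta>" and uv: "(u, v) \<in> quadratic_vanishing n \<Delta>"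
  shows "mono_poly (Poly_Mapping.single u 1 + Poly_Mapping.single v 1) \<in> (J_ideal n \<Delta> :: (var, 'a::field) mpoly set)"
proof -
  have "mono_poly (Poly_Mapping.single (X i) 1 + Poly_Mapping.single (X j) 1) \<in> (J_ideal n \<Delta> :: (var, 'a) mpoly set)"
    if "i \<in> {1..n}" "j \<in> {1..n}" "i \<noteq> j" "{i, j} \<notin> \<Delta>" for i j
    using J_ideal_props(2)[OF \<Delta>, of "{i, j}", where ?'a = 'a] that by (simp add: sqfree_def)
  then show ?thesis
    using uv J_ideal_props(3-5)[OF \<Delta>, where ?'a = 'a] unfolding quadratic_vanishing_def by blast
qed

text \<open>This is where flagness is needed: the nonface monomials must have quadratic divisors.\<close>

lemma vanishing_quadratic_divisor:
  assumes \<Delta>: "simplicial_complex n \<Delta>" and flag: "flag TYPE('a::field) n \<Delta>"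
    and m: "m \<in> monomials (T_vars n \<Delta>)" and van: "vanishing \<Delta> m"
  shows "\<exists>(u, v)\<in>quadratic_vanishing n \<Delta>.
    \<forall>w. lookup (Poly_Mapping.single u 1 + Poly_Mapping.single v 1) w \<le> lookup m w"
proof -
  have witness: ?thesis if "(u, v) \<in> quadratic_vanishing n \<Delta>" "0 < lookup m u" "0 < lookup m v"
    "u = v \<Longrightarrow> 2 \<le> lookup m u" for u v
    using that pair_dvd[OF that(2-4)] by blast
  have X: "i \<in> {1..n}" if "0 < lookup m (X i)" for i
  proof -
    have "X i \<in> keys m" using that by (simp add: in_keys_iff)
    then have "X i \<in> T_vars n \<Delta>" using m unfolding monomials_def by blast
    then show ?thesis by (auto simp: T_vars_def S_vars_def)
  qed
  consider "2 \<le> t_exp \<Delta> m" | i where "0 < lookup m (X i)" "0 < y_exp \<Delta> m i"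
    | "{i. 0 < lookup m (X i)} \<notin> \<Delta>"
    using van unfolding vanishing_def by blast
  then show ?thesis
  proof cases
    case 1
    have fin: "finite (facets \<Delta>)" by (rule facets_finite[OF \<Delta>])
    obtain F where F: "F \<in> facets \<Delta>" "0 < lookup m (Z F)"
    proof -
      have "t_exp \<Delta> m \<noteq> 0" using 1 by simp
      then obtain F where "F \<in> facets \<Delta>" "lookup m (Z F) \<noteq> 0"
        unfolding t_exp_def by (rule sum.not_neutral_contains_not_neutral)
      then show thesis using that by simp
    qed
    obtain G where G: "G \<in> facets \<Delta>" "0 < lookup m (Z G)" "F = G \<Longrightarrow> 2 \<le> lookup m (Z F)"
    proof (cases "2 \<le> lookup m (Z F)")
      case False
      have "t_exp \<Delta> m = lookup m (Z F) + (\<Sum>G\<in>facets \<Delta> - {F}. lookup m (Z G))"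
        unfolding t_exp_def by (rule sum.remove[OF fin F(1)])
      with False 1 have "(\<Sum>G\<in>facets \<Delta> - {F}. lookup m (Z G)) \<noteq> 0" by linarith
      then obtain G where "G \<in> facets \<Delta> - {F}" "lookup m (Z G) \<noteq> 0" by (rule sum.not_neutral_contains_not_neutral)
      then show thesis by (intro that[of G]) auto
    qed (use F that in blast)
    have "(Z F, Z G) \<in> quadratic_vanishing n \<Delta>"
      using F(1) G(1) unfolding quadratic_vanishing_def by blast
    then show ?thesis using F(2) G(2,3) by (intro witness[of "Z F" "Z G"]) auto
  next
    case 2
    show ?thesis
    proof (cases "0 < lookup m (Y i)")
      case True
      have "(X i, Y i) \<in> quadratic_vanishing n \<Delta>"
        using X[OF 2(1)] unfolding quadratic_vanishing_def by blast
      then show ?thesis using 2(1) True by (intro witness[of "X i" "Y i"]) auto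
    next
      case False
      then have "(\<Sum>F\<in>facets \<Delta>. if i \<in> F then 0 else lookup m (Z F)) \<noteq> 0"
        using 2(2) by (simp add: y_exp_def)
      then obtain F where F: "F \<in> facets \<Delta>" "(if i \<in> F then 0 else lookup m (Z F)) \<noteq> 0"
        by (rule sum.not_neutral_contains_not_neutral)
      then have iF: "i \<notin> F" "0 < lookup m (Z F)" by (auto split: if_splits)
      have "(X i, Z F) \<in> quadratic_vanishing n \<Delta>"
        using X[OF 2(1)] F(1) iF(1) unfolding quadratic_vanishing_def by blast
      then show ?thesis using 2(1) iF(2) by (intro witness[of "X i" "Z F"]) auto
    qed
  next
    case 3
    moreover have "{i. 0 < lookup m (X i)} \<subseteq> {1..n}" using X by blast
    ultimately obtain i j where ij: "0 < lookup m (X i)" "0 < lookup m (X j)" "i \<noteq> j" "{i, j} \<notin> \<Delta>"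
      using flag_nonface_edge[OF \<Delta> flag] by blast
    have "(X i, X j) \<in> quadratic_vanishing n \<Delta>"
      using X[OF ij(1)] X[OF ij(2)] ij(3,4) unfolding quadratic_vanishing_def by blast
    then show ?thesis using ij by (intro witness[of "X i" "X j"]) auto
  qed
qed

text \<open>Purity makes the second monomial of the binomial quadratic as well.\<close>

lemma poly_degree_b_poly:
  assumes \<Delta>: "simplicial_complex n \<Delta>" and pure: "pure_complex \<Delta>"
    and FG: "F \<in> facets \<Delta>" "G \<in> facets \<Delta>" and card: "card (F - G) = 1"
  shows "poly_degree (b_poly F G :: (var, 'a::field) mpoly) = 2"
proof -
  have fin: "finite F" "finite G" using FG facet_finite[OF \<Delta>] by auto
  have "F \<noteq> G" using card by auto
  have "card (G - F) = 1"
    using facets_card_eq[OF pure FG] card fin by (simp add: card_Diff_subset_Int Int_commute)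
  then show ?thesis
    using card by (simp add: poly_degree_def keys_b_poly[OF \<open>F \<noteq> G\<close>] mono_degree_yz)
qed

text \<open>For a lexicographic order in which later facets of the shelling have larger \<open>z_F\<close>, the quadratic
  vanishing monomials and quadratic binomials form a Groebner basis. A leading monomial \<open>m\<close> of an
  element of $J_\Delta$ either vanishes or contains some \<open>z_F\<close>, while a smaller \<open>m'\<close> of the same image contains
  \<open>z_E\<close> with \<open>E\<close> before \<open>F\<close>. Then every \<open>y_v\<close> with \<open>v\<close> in \<open>F - E\<close> divides \<open>m\<close>, and the shelling provides
  such a \<open>v\<close> for which \<open>y_v z_F\<close> is the leading monomial of a quadratic binomial.\<close>

lemma quadratic_if_shellable:
  assumes \<Delta>: "simplicial_complex n \<Delta>" and pure: "pure_complex \<Delta>"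
    and flag: "flag TYPE('a::field) n \<Delta>" and shell: "shellable n \<Delta>"
  shows "has_quadratic_groebner_basis (T_vars n \<Delta>) (J_ideal n \<Delta> :: (var, 'a) mpoly set)"
proof -
  let ?V = "T_vars n \<Delta>"
  let ?J = "J_ideal n \<Delta> :: (var, 'a) mpoly set"
  obtain Fs where dist: "distinct Fs" and Fs: "set Fs = facets \<Delta>"
    and step: "\<And>i j. i < j \<Longrightarrow> j < length Fs \<Longrightarrow>
      \<exists>k<j. \<exists>v\<in>Fs ! j. v \<notin> Fs ! i \<and> Fs ! j - {v} \<subseteq> Fs ! k"
    using shell unfolding shellable_iff[OF \<Delta> pure] by blast
  obtain ws where ws: "set ws = S_vars n"
    using finite_list[of "S_vars n"] by (auto simp: S_vars_def)
  define vs where "vs = map Z (rev Fs) @ ws"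
  have vs: "set vs = ?V" by (auto simp: vs_def ws Fs T_vars_def)
  define r where "r = lex_order vs"
  have r: "term_order ?V r" using term_order_lex_order[of vs] by (simp add: vs r_def)
  then have lin: "linear_order_on (monomials ?V) r" by (simp add: term_order_def)
  note J = J_ideal_props[OF \<Delta>, where ?'a = 'a]
  have J_carr: "?J \<subseteq> carrier (poly_ring ?V)" using J(1) by (auto simp: image_kernel_def)
  let ?pair = "\<lambda>(u, v). mono_poly (Poly_Mapping.single u 1 + Poly_Mapping.single v 1) :: (var, 'a) mpoly"
  define B where "B = (\<lambda>(F, G). b_poly F G :: (var, 'a) mpoly) `
    {(F, G). F \<in> facets \<Delta> \<and> G \<in> facets \<Delta> \<and> card (F - G) = 1}"
  define G where "G = ?pair ` quadratic_vanishing n \<Delta> \<union> B"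
  have "groebner_basis ?V r ?J G"
    unfolding groebner_basis_iff[OF lin J_carr]
  proof (intro conjI ballI impI)
    have "finite ?V" using vs by (metis List.finite_set)
    then have "finite (quadratic_vanishing n \<Delta>)"
      using finite_subset[OF quadratic_vanishing_subset] by blast
    moreover have "finite B"
      unfolding B_def
      by (intro finite_imageI finite_subset[OF _ finite_cartesian_product[OF facets_finite[OF \<Delta>] facets_finite[OF \<Delta>]]]) auto
    ultimately show "finite G" by (simp add: G_def)
    have "B \<subseteq> ?J"
    proof -
      have "b_poly F H \<in> ?J" if "F \<in> facets \<Delta>" "H \<in> facets \<Delta>" "card (F - H) = 1" for F H
        using that(3) by (intro J(6) that) auto
      then show ?thesis by (auto simp: B_def)
    qed
    then show "G \<subseteq> ?J" using quadratic_vanishing_in_J[OF \<Delta>] by (auto simp: G_def simp del: One_nat_def)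
  next
    fix p assume p: "p \<in> ?J" "p \<noteq> 0"
    define m where "m = leading_monomial r p"
    have carr: "p \<in> carrier (poly_ring ?V)" using p(1) J_carr by blast
    note lead = leading_monomial_props[OF lin carr p(2), folded m_def]
    have m: "m \<in> monomials ?V" by (rule keys_carrier[OF carr lead(1)])
    show "\<exists>g\<in>G. g \<noteq> 0 \<and> (\<forall>w. lookup (leading_monomial r g) w \<le> lookup (leading_monomial r p) w)"
      unfolding m_def[symmetric]
    proof (cases "vanishing \<Delta> m")
      case True
      obtain u v where uv: "(u, v) \<in> quadratic_vanishing n \<Delta>"
        "\<forall>w. lookup (Poly_Mapping.single u 1 + Poly_Mapping.single v 1) w \<le> lookup m w"
        using vanishing_quadratic_divisor[OF \<Delta> flag m True] by blast
      then have "Poly_Mapping.single u 1 + Poly_Mapping.single v 1 \<in> monomials ?V"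
        using quadratic_vanishing_subset by (blast intro: monomials_pair)
      then have "leading_monomial r (?pair (u, v)) = Poly_Mapping.single u 1 + Poly_Mapping.single v 1"
        unfolding prod.case by (rule leading_monomial_mono_poly[OF lin])
      moreover have "?pair (u, v) \<in> G" unfolding G_def using uv(1) by blast
      moreover have "?pair (u, v) \<noteq> 0" by simp
      ultimately show "\<exists>g\<in>G. g \<noteq> 0 \<and> (\<forall>w. lookup (leading_monomial r g) w \<le> lookup m w)"
        using uv(2) by metis
    next
      case False
      have "p \<in> image_kernel \<Delta> ?V" using p(1) J(1) by blast
      then obtain m' where m': "m' \<in> keys p" "m' \<noteq> m" "same_image \<Delta> m' m"
        using kernel_key[OF _ lead(1) False] by blast
      have m'_mon: "m' \<in> monomials ?V" by (rule keys_carrier[OF carr m'(1)])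
      note t1 = t_exp_eq_1[OF \<Delta> m m'_mon m'(3,2) False]
      obtain F where F: "F \<in> facets \<Delta>"
          "\<And>G. G \<in> facets \<Delta> \<Longrightarrow> lookup m (Z G) = (if G = F then 1 else 0)"
          "\<And>i. y_exp \<Delta> m i = lookup m (Y i) + (if i \<in> F then 0 else 1)"
        using t_exp_1[OF \<Delta> t1(1)] by metis
      obtain E where E: "E \<in> facets \<Delta>"
          "\<And>G. G \<in> facets \<Delta> \<Longrightarrow> lookup m' (Z G) = (if G = E then 1 else 0)"
          "\<And>i. y_exp \<Delta> m' i = lookup m' (Y i) + (if i \<in> E then 0 else 1)"
        using t_exp_1[OF \<Delta> t1(2)] by metis
      have "E \<noteq> F" using same_image_eqI[OF m'(3) m'_mon m] F(2) E(2) m'(2) by auto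
      obtain i j where ij: "i < length Fs" "E = Fs ! i" "j < length Fs" "F = Fs ! j"
        using E(1) F(1) Fs by (metis in_set_conv_nth)
      have "i < j"
      proof (rule ccontr)
        assume "\<not> i < j"
        then have "j < i" using \<open>E \<noteq> F\<close> ij(2,4) by (metis linorder_neqE_nat)
        then have "lex_le vs m m'"
          unfolding vs_def by (rule lex_le_facets[OF dist _ ij(1)]) (use F(2) E(2) ij Fs in auto)
        then have "(m, m') \<in> r" using m m'_mon by (simp add: r_def lex_order_def vs)
        then show False using lead(2)[OF m'(1)] linear_order_antisym[OF lin] m'(2) by blast
      qed
      from step[OF this ij(3)] obtain k v where kv: "k < j" "v \<in> F" "v \<notin> E" "F - {v} \<subseteq> Fs ! k"
        unfolding ij(2,4) by blast
      define H where "H = Fs ! k"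
      have H: "H \<in> facets \<Delta>" "H \<noteq> F"
        using kv(1) ij(3,4) dist nth_mem[of k Fs] by (auto simp: H_def Fs nth_eq_iff_index_eq)
      have FH: "F - H = {v}" using kv(2,4) facet_subset_eq[OF F(1) H(1)] H(2) unfolding H_def by blast
      \<comment> \<open>In the image of \<open>m\<close> no factor \<open>y_v\<close> comes from \<open>z_F\<close>, in that of \<open>m'\<close> one comes from \<open>z_E\<close>.\<close>
      have "lookup m (Y v) = lookup m' (Y v) + 1"
        using F(3)[of v] E(3)[of v] kv(2,3) m'(3) by (simp add: same_image_def)
      then have yv: "0 < lookup m (Y v)" by simp
      have yz_mon: "yz A F' \<in> monomials ?V" if "F' \<in> facets \<Delta>" "A \<subseteq> F'" for A F'
        using that face_subset[OF \<Delta> facet_face[OF that(1)]] by (intro monomials_yz) auto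
      have "lex_le vs (yz (H - F) H) (yz (F - H) F)"
        unfolding vs_def
        by (rule lex_le_facets[OF dist kv(1) ij(3)]) (auto simp: lookup_yz H_def ij(4))
      then have less: "(yz (H - F) H, yz (F - H) F) \<in> r"
        using yz_mon[OF H(1), of "H - F"] yz_mon[OF F(1), of "F - H"]
        by (simp add: r_def lex_order_def vs)
      let ?b = "b_poly F H :: (var, 'a) mpoly"
      have keys_b: "keys ?b = {yz (F - H) F, yz (H - F) H}"
        using keys_b_poly H(2) by blast
      have lm: "leading_monomial r ?b = yz (F - H) F"
        by (rule leading_monomial_eqI[OF lin])
          (use keys_b less lin yz_mon[OF F(1), of "F - H"] in \<open>auto simp: order_on_defs refl_on_def\<close>)
      have "lookup (yz (F - H) F) w \<le> lookup m w" for w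
        by (cases w) (use yv F(2)[OF F(1)] in \<open>auto simp: FH lookup_yz Suc_le_eq\<close>)
      moreover have "?b \<in> G" using F(1) H(1) FH by (auto simp: G_def B_def)
      moreover have "?b \<noteq> 0" using keys_b by auto
      ultimately show "\<exists>g\<in>G. g \<noteq> 0 \<and> (\<forall>w. lookup (leading_monomial r g) w \<le> lookup m w)"
        using lm by metis
    qed
  qed
  moreover have "poly_degree g = 2" if "g \<in> G" for g
  proof -
    have "poly_degree (?pair (u, v)) = 2" for u v by (simp add: mono_degree_plus)
    then show ?thesis
      using that poly_degree_b_poly[OF \<Delta> pure] unfolding G_def B_def by auto
  qed
  ultimately show ?thesis using r unfolding has_quadratic_groebner_basis_def by blast
qed

theorem theorem3:
  fixes n :: nat and \<Delta> :: "nat set set"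
  assumes "simplicial_complex n \<Delta>"
    and "pure_complex \<Delta>"
    and "flag TYPE('a::field) n \<Delta>"
  shows "has_quadratic_groebner_basis (T_vars n \<Delta>) (J_ideal n \<Delta> :: (var, 'a) mpoly set)
         \<longleftrightarrow> shellable n \<Delta>"
  using shellable_if_quadratic[OF assms(1,2)] quadratic_if_shellable[OF assms]
  unfolding has_quadratic_groebner_basis_def by blast

end
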